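(* Let $G$ be a function holomorphic in a neighborhood of the unit circle $\mathbb{T}$ with $G(z)\in i\mathbb{R}$ for $z\in\mathbb{T}$ (equivalently $\hat G(-k)=-\overline{\hat G(k)}$ for all $k\in\mathbb{Z}$), and set $F(z)=\exp(G(z^{-1}))$. Let $K_F$ be the kernel of the orthogonal projection of $l^2(\mathbb{Z})$ onto $\mathcal{E}_F=\mathcal{F}(FH^2(\mathbb{T}))$. Let $\rho:\Lambda\to\mathbb{C}$ be the specialization of the algebra of symmetric functions defined by $\rho(p_k)=k\hat G(k)$, $k=1,2,\dots$, and let $K_\rho$ be the correlation kernel, given in the context, associated with the symmetric Schur measure with specialization $\rho$. Then for all $x,y\in\mathbb{Z}$, $$K_F(x,y)=K_\rho(-x,-y).$$
   Context: $\mathbb{T}=\{z\in\mathbb{C}:|z|=1\}$ carries normalized Lebesgue measure; $\hat F(k)=\frac1{2\pi}\int_{-\pi}^{\pi}e^{-i\theta k}F(e^{i\theta})\,d\theta$; $\mathcal{F}:L^2(\mathbb{T})\to l^2(\mathbb{Z})$, $F\mapsto(\hat F(k))_{k\in\mathbb{Z}}$, is the Fourier–Plancherel isomorphism; $H^2(\mathbb{T})=\{F\in L^2(\mathbb{T}):\hat F(k)=0,\ k=-1,-2,\dots\}$. The kernel $K(x,y)$ of an operator on $l^2(\mathbb{Z})$ is its matrix, $(Kf)(x)=\sum_yK(x,y)f(y)$. $\Lambda$ is the $\mathbb{C}$-algebra of symmetric functions, $p_k$ are the Newton power sums, and a specialization is an algebra morphism $\Lambda\to\mathbb{C}$. The symmetric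 Schur measure with specialization $\rho$ is the probability measure on partitions proportional to $|\rho(s_\lambda)|^2$ ($s_\lambda$ Schur functions). For $\rho$ such that $\sum_{k\ge1}\frac{\rho(p_k)}{k}z^k$ is holomorphic in a neighborhood of $\mathbb{T}$, the kernel $K_\rho$ is given by $$K_\rho(x,y)=\frac1{(2i\pi)^2}\int_{|z|=1+\varepsilon}\int_{|w|=1-\varepsilon}\exp\left(\sum_{k=1}^{\infty}\frac{\rho(p_k)}{k}(z^k-w^k)+\frac{\overline{\rho(p_k)}}{k}(w^{-k}-z^{-k})\right)\frac{1}{z-w}\,\frac{dz\,dw}{z^{x}w^{-y+1}},\quad x,y\in\mathbb{Z},$$ with $\varepsilon>0$ sufficiently small. *)

theory Defs
  imports "HOL-Complex_Analysis.Complex_Analysis" "HOL-Library.Multiset"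
begin

section \<open>Symmetric functions\<close>

text \<open>
  A formal power series over the complex numbers in the variables \<open>x\<^sub>0, x\<^sub>1, \<dots>\<close> is given by its
  coefficients; the monomial \<open>x\<^sub>i \<cdots> x\<^sub>j\<close> is encoded as the multiset of indices \<open>{#i, \<dots>, j#}\<close>, so
  that the product of monomials is the sum of multisets and the total degree is the size.
\<close>

type_synonym series = "nat multiset \<Rightarrow> complex"

text \<open>\<open>\<Lambda>\<close>: series of bounded degree, invariant under permutations of the variables.\<close>

definition Sym :: "series set" where
  "Sym = {f. (\<exists>d. \<forall>M. f M \<noteq> 0 \<longrightarrow> size M \<le> d) \<and>
             (\<forall>\<pi>. bij \<pi> \<longrightarrow> (\<forall>M. f (image_mset \<pi> M) = f M))}"

definition series_one :: series where
  "series_one M = (if M = {#} then 1 else 0)"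

definition series_add :: "series \<Rightarrow> series \<Rightarrow> series" where
  "series_add f g M = f M + g M"

definition series_smult :: "complex \<Rightarrow> series \<Rightarrow> series" where
  "series_smult c f M = c * f M"

definition series_mult :: "series \<Rightarrow> series \<Rightarrow> series" where
  "series_mult f g M = (\<Sum>A\<in>{A. A \<subseteq># M}. f A * g (M - A))"

text \<open>The power sum \<open>p\<^sub>k = \<Sum>\<^sub>i x\<^sub>i\<^sup>k\<close>; meaningful for \<open>k \<ge> 1\<close> only.\<close>

definition power_sum :: "nat \<Rightarrow> series" where
  "power_sum k M = (if \<exists>i. M = replicate_mset k i then 1 else 0)"

text \<open>Morphisms of unital complex algebras from \<open>\<Lambda>\<close> to the complex numbers; values of \<open>\<rho>\<close> outside
  \<^const>\<open>Sym\<close> are irrelevant.\<close>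

definition specialization :: "(series \<Rightarrow> complex) \<Rightarrow> bool" where
  "specialization \<rho> \<longleftrightarrow>
     \<rho> series_one = 1 \<and>
     (\<forall>f\<in>Sym. \<forall>g\<in>Sym. \<rho> (series_add f g) = \<rho> f + \<rho> g) \<and>
     (\<forall>f\<in>Sym. \<forall>g\<in>Sym. \<rho> (series_mult f g) = \<rho> f * \<rho> g) \<and>
     (\<forall>c. \<forall>f\<in>Sym. \<rho> (series_smult c f) = c * \<rho> f)"

lemma series_one_in_Sym: "series_one \<in> Sym"
  by (auto simp: Sym_def series_one_def)

lemma series_add_in_Sym:
  assumes "f \<in> Sym" "g \<in> Sym"
  shows "series_add f g \<in> Sym"
proof -
  obtain d e where "\<forall>M. f M \<noteq> 0 \<longrightarrow> size M \<le> d" "\<forall>M. g M \<noteq> 0 \<longrightarrow> size M \<le> e"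
    using assms by (auto simp: Sym_def)
  then have "\<forall>M. f M + g M \<noteq> 0 \<longrightarrow> size M \<le> max d e"
    by (metis add_0 le_max_iff_disj)
  with assms show ?thesis
    by (auto simp: Sym_def series_add_def)
qed

lemma series_smult_in_Sym: "f \<in> Sym \<Longrightarrow> series_smult c f \<in> Sym"
  by (auto simp: Sym_def series_smult_def)

lemma series_mult_in_Sym:
  assumes "f \<in> Sym" "g \<in> Sym"
  shows "series_mult f g \<in> Sym"
proof -
  obtain d e where d: "\<forall>M. f M \<noteq> 0 \<longrightarrow> size M \<le> d" and e: "\<forall>M. g M \<noteq> 0 \<longrightarrow> size M \<le> e"
    using assms by (auto simp: Sym_def)
  have "size M \<le> d + e" if "series_mult f g M \<noteq> 0" for M
  proof -
    from that obtain A where "A \<in> {A. A \<subseteq># M}" "f A * g (M - A) \<noteq> 0"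
      unfolding series_mult_def by (rule sum.not_neutral_contains_not_neutral)
    with d e have "size A \<le> d" "size (M - A) \<le> e" "size M = size A + size (M - A)"
      by (auto simp: size_Diff_submset dest: size_mset_mono)
    then show ?thesis by linarith
  qed
  moreover have "series_mult f g (image_mset \<pi> M) = series_mult f g M" if "bij \<pi>" for \<pi> M
  proof -
    have inv: "image_mset (inv \<pi>) (image_mset \<pi> A) = A" "image_mset \<pi> (image_mset (inv \<pi>) A) = A"
      for A :: "nat multiset"
      using that by (auto simp: multiset.map_comp bij_def inj_iff surj_iff multiset.map_id)
    have sym: "f (image_mset \<pi> A) = f A" "g (image_mset \<pi> A) = g A" for A
      using assms that by (auto simp: Sym_def)
    show ?thesis
      unfolding series_mult_def
    proof (rule sum.reindex_bij_witness[where j = "image_mset (inv \<pi>)" and i = "image_mset \<pi>"])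
      fix A assume "A \<in> {A. A \<subseteq># image_mset \<pi> M}"
      then have "image_mset (inv \<pi>) A \<subseteq># M"
        by (metis image_mset_subseteq_mono inv(1) mem_Collect_eq)
      then show "image_mset (inv \<pi>) A \<in> {A. A \<subseteq># M}" by simp
      have "image_mset \<pi> M - A = image_mset \<pi> (M - image_mset (inv \<pi>) A)"
        using \<open>image_mset (inv \<pi>) A \<subseteq># M\<close> by (simp add: image_mset_Diff inv)
      then show "f (image_mset (inv \<pi>) A) * g (M - image_mset (inv \<pi>) A) =
          f A * g (image_mset \<pi> M - A)"
        using sym by (metis inv(2))
    qed (auto simp: inv image_mset_subseteq_mono)
  qed
  ultimately show ?thesis
    by (auto simp: Sym_def)
qed

lemma power_sum_in_Sym: "power_sum k \<in> Sym"
proof -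
  have "(\<exists>i. image_mset \<pi> M = replicate_mset k i) \<longleftrightarrow> (\<exists>i. M = replicate_mset k i)"
    if "bij \<pi>" for \<pi> :: "nat \<Rightarrow> nat" and M
  proof
    assume "\<exists>i. image_mset \<pi> M = replicate_mset k i"
    then obtain i where "image_mset \<pi> M = replicate_mset k i" ..
    then have "image_mset (inv \<pi>) (image_mset \<pi> M) = replicate_mset k (inv \<pi> i)"
      by simp
    then show "\<exists>i. M = replicate_mset k i"
      using that by (auto simp: multiset.map_comp bij_def inj_iff multiset.map_id)
  qed auto
  then show ?thesis
    by (auto simp: Sym_def power_sum_def)
qed

section \<open>Fourier analysis on the unit circle\<close>

text \<open>Normalized Lebesgue measure on the unit circle. Elements of \<open>L\<^sup>2\<close> are represented by functions;
  functions that agree almost everywhere have the same Fourier coefficients.\<close>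

definition circle_measure :: "complex measure" where
  "circle_measure =
     distr (uniform_measure lborel {-pi..pi}) (restrict_space borel (sphere 0 1)) cis"

definition L2_circle :: "(complex \<Rightarrow> complex) set" where
  "L2_circle = {F \<in> borel_measurable circle_measure.
                  integrable circle_measure (\<lambda>z. (norm (F z))\<^sup>2)}"

definition fourier :: "(complex \<Rightarrow> complex) \<Rightarrow> int \<Rightarrow> complex" where
  "fourier F k =
     1 / (2 * of_real pi) *
       (LBINT \<theta>:{-pi..pi}. exp (- (\<i> * of_real \<theta> * of_int k)) * F (exp (\<i> * of_real \<theta>)))"

definition H2_circle :: "(complex \<Rightarrow> complex) set" where
  "H2_circle = {F \<in> L2_circle. \<forall>k<0. fourier F k = 0}"

definition fourier_H2 :: "(complex \<Rightarrow> complex) \<Rightarrow> (int \<Rightarrow> complex) set" where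
  "fourier_H2 F = fourier ` {\<lambda>z. F z * H z |H. H \<in> H2_circle}"

section \<open>Operators on square-summable sequences\<close>

definition ell2 :: "(int \<Rightarrow> complex) set" where
  "ell2 = {f. (\<lambda>n. (norm (f n))\<^sup>2) summable_on UNIV}"

definition ell2_inner :: "(int \<Rightarrow> complex) \<Rightarrow> (int \<Rightarrow> complex) \<Rightarrow> complex" where
  "ell2_inner f g = (\<Sum>\<^sub>\<infinity>n. f n * cnj (g n))"

definition orthogonal_projection ::
    "(int \<Rightarrow> complex) set \<Rightarrow> (int \<Rightarrow> complex) \<Rightarrow> (int \<Rightarrow> complex)" where
  "orthogonal_projection E f =
     (THE g. g \<in> E \<and> (\<forall>h\<in>E. ell2_inner (\<lambda>n. f n - g n) h = 0))"

definition has_kernel ::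
    "((int \<Rightarrow> complex) \<Rightarrow> (int \<Rightarrow> complex)) \<Rightarrow> (int \<Rightarrow> int \<Rightarrow> complex) \<Rightarrow> bool" where
  "has_kernel A K \<longleftrightarrow>
     (\<forall>f\<in>ell2. \<forall>x. ((\<lambda>y. K x y * f y) has_sum A f x) UNIV)"

lemma has_kernel_entry:
  assumes "has_kernel A K"
  shows "K x y = A (\<lambda>n. if n = y then 1 else 0) x"
proof -
  let ?e = "\<lambda>n. if n = y then 1 else 0 :: complex"
  have "?e \<in> ell2"
    unfolding ell2_def mem_Collect_eq
    by (rule summable_on_cong_neutral[THEN iffD1, OF _ _ _ summable_on_finite[of "{y}"]]) auto
  then have "((\<lambda>n. K x n * ?e n) has_sum A ?e x) UNIV"
    using assms[unfolded has_kernel_def, THEN bspec, THEN spec] by simp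
  moreover have "((\<lambda>n. K x n * ?e n) has_sum K x y) UNIV"
    using has_sum_finite[of "{y}" "\<lambda>n. K x n * ?e n"]
    by (subst has_sum_cong_neutral[where T = "{y}" and g = "\<lambda>n. K x n * ?e n"]) auto
  ultimately show ?thesis
    using has_sum_unique by blast
qed

text \<open>By the previous lemma an operator has at most one kernel.\<close>

definition operator_kernel ::
    "((int \<Rightarrow> complex) \<Rightarrow> (int \<Rightarrow> complex)) \<Rightarrow> int \<Rightarrow> int \<Rightarrow> complex" where
  "operator_kernel A = (THE K. has_kernel A K)"

section \<open>The correlation kernel of the symmetric Schur measure\<close>

text \<open>The kernel depends on the radii \<open>1 \<plusminus> \<epsilon>\<close> of the contours through the parameter \<open>\<epsilon>\<close>; it is to be
  used with \<open>\<epsilon> > 0\<close> sufficiently small. The index \<open>k\<close> is shifted by one in the series.\<close>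

definition schur_exponent :: "(series \<Rightarrow> complex) \<Rightarrow> complex \<Rightarrow> complex \<Rightarrow> complex" where
  "schur_exponent \<rho> z w =
     (\<Sum>k. \<rho> (power_sum (Suc k)) / of_nat (Suc k) * (z ^ Suc k - w ^ Suc k) +
          cnj (\<rho> (power_sum (Suc k))) / of_nat (Suc k) *
            (w powi (- int (Suc k)) - z powi (- int (Suc k))))"

definition schur_kernel :: "(series \<Rightarrow> complex) \<Rightarrow> real \<Rightarrow> int \<Rightarrow> int \<Rightarrow> complex" where
  "schur_kernel \<rho> \<epsilon> x y =
     1 / (2 * \<i> * of_real pi)\<^sup>2 *
       contour_integral (circlepath 0 (1 + \<epsilon>)) (\<lambda>z.
         contour_integral (circlepath 0 (1 - \<epsilon>)) (\<lambda>w.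
           exp (schur_exponent \<rho> z w) * (1 / (z - w)) * (1 / (z powi x * w powi (- y + 1)))))"

end

theory Submission
  imports Defs
begin

text \<open>
  Let \<open>c\<close> be the Fourier coefficients of \<open>F\<close>, which are absolutely summable. By Riesz--Fischer,
  \<open>\<E>\<^sub>F\<close> is the image of the sequences in \<open>l\<^sup>2\<close> supported on \<open>n \<ge> 0\<close> under convolution with \<open>c\<close>, and
  this convolution is unitary because \<open>\<bar>F\<bar> = 1\<close> on the circle. Hence the projection onto \<open>\<E>\<^sub>F\<close> has the
  kernel \<open>\<Sum>\<^sub>n\<^sub>\<ge>\<^sub>0 c(x - n) cnj c(y - n)\<close>. On the other side, the antisymmetry of the coefficients of \<open>G\<close>
  identifies the exponent of the Schur kernel with \<open>G(z) - G(w)\<close> on an annulus, and expanding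
  \<open>1/(z - w)\<close> into \<open>\<Sum>\<^sub>n\<^sub>\<ge>\<^sub>0 w\<^sup>n/z\<^sup>n\<^sup>+\<^sup>1\<close> turns the double integral into
  \<open>\<Sum>\<^sub>n\<^sub>\<ge>\<^sub>0 a(x + n) cnj a(y + n)\<close>, where \<open>a(n) = c(-n)\<close> are the coefficients of \<open>exp \<circ> G\<close>.
\<close>

section \<open>Fourier coefficients of square-integrable functions\<close>

text \<open>\<open>orthogonal_projection\<close> and \<open>operator_kernel\<close> are definite
  descriptions, so existence and uniqueness must be produced. Let C be convolution with
  \<open>c\<close>, C' its adjoint and T the cut-off of negative indices. Since C' C = 1, the
  product C T C' is an explicit candidate for the projection, and no closedness argument for the
  subspace is required. The subspace is defined through functions, however, and the candidate lies
  in it only because every half-line sequence in l2 comes from an H2 function; this is where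
  Riesz-Fischer enters. Absolute summability of \<open>c\<close>, a consequence of holomorphy on an
  annulus, justifies the interchanges of convolution sums. The two sides are written in different
  languages: Lebesgue integrals over \<open>{-pi..pi}\<close> against contour integrals over circles
  of radius other than one. The bridge is that Laurent coefficients do not depend on the radius. It
  applies to holomorphic functions only, so the conjugate of exp G is replaced by exp(-G), which
  agrees with it on the unit circle.\<close>

lemma norm_powi_sphere: "z \<in> sphere 0 1 \<Longrightarrow> norm (z powi k :: complex) = 1"
  by (simp add: norm_power_int)

lemma cnj_powi_sphere: "z \<in> sphere 0 1 \<Longrightarrow> cnj (z powi k) = z powi (- k)"
proof -
  assume z: "z \<in> sphere 0 1"
  then have "cnj (z powi k) * z powi k = 1"
    using norm_powi_sphere[OF z, of k] complex_norm_square[of "z powi k"] by (simp add: mult.commute)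
  moreover have "z powi (- k) * z powi k = 1"
    using z by (subst power_int_add[symmetric]) auto
  ultimately show ?thesis
    using z by (metis mult_right_cancel mult_zero_right zero_neq_one)
qed

lemma powi_add_sphere: "z \<in> sphere 0 1 \<Longrightarrow> z powi a * z powi b = (z powi (a + b) :: complex)"
  by (subst power_int_add) auto

section \<open>The normalized measure on the circle and integrals of characters\<close>

lemma sets_circle_measure [measurable_cong]:
  "sets circle_measure = sets (restrict_space borel (sphere 0 1))"
  by (simp add: circle_measure_def)

lemma space_circle_measure [simp]: "space circle_measure = sphere 0 1"
  by (simp add: circle_measure_def space_restrict_space)

lemma measurable_cis [measurable]:
  "cis \<in> measurable lborel (restrict_space borel (sphere 0 1))"
  by (rule measurable_restrict_space2)
    (auto intro!: borel_measurable_continuous_onI continuous_intros)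

lemma borel_measurable_circle_continuous:
  fixes F :: "complex \<Rightarrow> 'b :: topological_space"
  assumes "continuous_on (sphere 0 1) F"
  shows "F \<in> borel_measurable circle_measure"
  using borel_measurable_continuous_on_restrict[OF assms]
  by (simp cong: measurable_cong_sets add: sets_circle_measure)

lemma uniform_measure_interval:
  "uniform_measure lborel {-pi..pi} =
     density lborel (\<lambda>x. ennreal (indicator {-pi..pi} x / (2 * pi)))"
  unfolding uniform_measure_def
  by (rule density_cong) (auto simp: indicator_def divide_ennreal[symmetric] ennreal_1[symmetric] simp del: ennreal_1)

text \<open>Links the two definitions in use: \<open>L2_circle\<close> refers to the abstract
  measure, \<open>fourier\<close> to an integral over an interval of length 2 pi.\<close>

lemma integral_circle_measure:
  fixes F :: "complex \<Rightarrow> 'b :: {banach, second_countable_topology}"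
  assumes [measurable]: "F \<in> borel_measurable circle_measure"
  shows "integral\<^sup>L circle_measure F = (1 / (2 * pi)) *\<^sub>R (LBINT \<theta>:{-pi..pi}. F (cis \<theta>))"
proof -
  have 1 [measurable]: "F \<in> borel_measurable (restrict_space borel (sphere 0 1))"
    using assms by (simp cong: measurable_cong_sets add: sets_circle_measure)
  have 2 [measurable]: "(\<lambda>\<theta>. F (cis \<theta>)) \<in> borel_measurable lborel"
    by measurable
  have "integral\<^sup>L circle_measure F = (\<integral>\<theta>. F (cis \<theta>) \<partial>uniform_measure lborel {-pi..pi})"
    unfolding circle_measure_def
    by (rule integral_distr) (auto cong: measurable_cong_sets)
  also have "\<dots> = (LBINT \<theta>. (indicator {-pi..pi} \<theta> / (2 * pi)) *\<^sub>R F (cis \<theta>))"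
    unfolding uniform_measure_interval
    by (rule integral_density) (auto simp: indicator_def)
  also have "\<dots> = (LBINT \<theta>. (1 / (2 * pi)) *\<^sub>R indicator {-pi..pi} \<theta> *\<^sub>R F (cis \<theta>))"
    by (rule Bochner_Integration.integral_cong) auto
  finally show ?thesis
    by (simp only: set_lebesgue_integral_def integral_scaleR_right)
qed


lemma emeasure_circle_measure [simp]: "emeasure circle_measure (sphere 0 1) = 1"
proof -
  have cis: "cis -` sphere 0 1 = UNIV" by auto
  have sph: "sphere 0 1 \<in> sets (restrict_space borel (sphere 0 (1::real) :: complex set))"
    by (metis sets.top space_restrict_space2 borel_closed closed_sphere)
  have "emeasure circle_measure (sphere 0 1) = emeasure (uniform_measure lborel {-pi..pi}) UNIV"
    unfolding circle_measure_def
    by (subst emeasure_distr[OF _ sph]) (auto simp: cis cong: measurable_cong_sets)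
  also have "\<dots> = ennreal (2 * pi) / ennreal (2 * pi)"
    by (subst emeasure_uniform_measure) auto
  also have "\<dots> = 1"
    by (subst divide_ennreal) auto
  finally show ?thesis .
qed

lemma measure_circle_measure [simp]: "measure circle_measure (sphere 0 1) = 1"
  by (simp add: measure_def)

lemma finite_measure_circle: "finite_measure circle_measure"
  by (rule finite_measureI) simp

lemma borel_measurable_cnj:
  "F \<in> borel_measurable M \<Longrightarrow> (\<lambda>x. cnj (F x)) \<in> borel_measurable M"
  by (rule measurable_compose[of F M borel cnj])
    (auto intro!: borel_measurable_continuous_onI continuous_intros)

lemma borel_measurable_powi_circle [measurable]:
  "(\<lambda>z. z powi k) \<in> borel_measurable circle_measure"
  by (rule borel_measurable_circle_continuous) (auto intro!: continuous_intros)

lemma fourier_eq_integral: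
  assumes [measurable]: "F \<in> borel_measurable circle_measure"
  shows "fourier F k = (\<integral>z. z powi (- k) * F z \<partial>circle_measure)"
proof -
  have e: "exp (- (\<i> * of_real \<theta> * of_int k)) = cis \<theta> powi (- k)" for \<theta> :: real
    by (simp add: cis_conv_exp exp_power_int mult_ac)
  have "(\<integral>z. z powi (- k) * F z \<partial>circle_measure) =
      (1 / (2 * pi)) *\<^sub>R (LBINT \<theta>:{-pi..pi}. cis \<theta> powi (- k) * F (cis \<theta>))"
    by (rule integral_circle_measure) measurable
  then show ?thesis
    by (simp only: fourier_def e cis_conv_exp[symmetric]) (simp add: scaleR_conv_of_real)
qed

lemma integrable_powi_mult_circle:
  assumes "integrable circle_measure F"
  shows "integrable circle_measure (\<lambda>z. z powi k * F z)"
  by (rule Bochner_Integration.integrable_bound[OF assms])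
    (use assms in \<open>auto intro!: AE_I2 simp: norm_mult norm_power_int\<close>)

lemma integrable_powi_circle: "integrable circle_measure (\<lambda>z. z powi k)"
  by (rule finite_measure.integrable_const_bound[OF finite_measure_circle, of _ 1])
    (auto intro!: AE_I2 simp: norm_power_int)

lemma integral_powi_circle: "(\<integral>z. z powi k \<partial>circle_measure) = (if k = 0 then 1 else 0)"
proof (cases "k = 0")
  case True
  then show ?thesis by simp
next
  case False
  have e: "cis \<theta> powi k = exp (\<i> * of_real (of_int k * \<theta>))" for \<theta>
    by (simp add: cis_conv_exp exp_power_int mult_ac)
  have "(\<integral>z. z powi k \<partial>circle_measure) = (1 / (2 * pi)) *\<^sub>R (LBINT \<theta>:{-pi..pi}. cis \<theta> powi k)"
    by (rule integral_circle_measure) measurable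
  also have "(LBINT \<theta>:{-pi..pi}. cis \<theta> powi k) =
      (LBINT \<theta>. indicator {-pi..pi} \<theta> *\<^sub>R exp (\<i> * of_real (of_int k * \<theta>)))"
    by (simp add: set_lebesgue_integral_def e)
  also have "\<dots> = exp (\<i> * of_real (of_int k * pi)) / (\<i> * of_int k)
      - exp (\<i> * of_real (of_int k * (- pi))) / (\<i> * of_int k)"
  proof (rule integral_FTC_Icc)
    show "((\<lambda>\<theta>. exp (\<i> * of_real (of_int k * \<theta>)) / (\<i> * of_int k)) has_vector_derivative
        exp (\<i> * of_real (of_int k * x))) (at x within {-pi..pi})" for x
    proof -
      have "((\<lambda>\<theta>. exp (\<i> * (of_int k * \<theta>)) / (\<i> * of_int k)) has_field_derivative
        exp (\<i> * (of_int k * of_real x))) (at (of_real x))"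
        using False by (auto intro!: derivative_eq_intros simp: mult.left_commute[of \<i>])
      from has_vector_derivative_real_field[OF this] show ?thesis
        by simp
    qed
  qed (auto intro!: continuous_intros)
  \<comment> \<open>The boundary terms cancel because \<open>k\<close> is an integer: the two
    exponents differ by a multiple of 2 pi i.\<close>
  also have "exp (\<i> * of_real (of_int k * (- pi))) = exp (\<i> * of_real (of_int k * pi))"
  proof -
    have "exp (\<i> * of_real (of_int k * (- pi))) * exp (2 * of_int k * of_real pi * \<i>) =
        exp (\<i> * of_real (of_int k * pi))"
      by (subst exp_add[symmetric]) (simp add: algebra_simps)
    moreover have "exp (2 * of_int k * of_real pi * \<i>) = 1"
      using exp_integer_2pi[of "of_int k"] by simp
    ultimately show ?thesis by simp
  qed
  finally show ?thesis using False by simp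
qed

lemma fourier_powi: "fourier (\<lambda>z. z powi m) k = (if k = m then 1 else 0)"
proof -
  have "z powi (- k) * z powi m = z powi (m - k)" if "z \<in> sphere 0 1" for z :: complex
    by (simp add: powi_add_sphere[OF that])
  then have "fourier (\<lambda>z. z powi m) k = (\<integral>z. z powi (m - k) \<partial>circle_measure)"
    by (subst fourier_eq_integral) (auto intro!: Bochner_Integration.integral_cong)
  then show ?thesis by (simp add: integral_powi_circle)
qed

text \<open>The total mass is finite, and t \<le> 1 + t^2 for every t \<ge> 0, so square-integrable
  functions are integrable.\<close>

lemma L2_circle_integrable:
  assumes "H \<in> L2_circle"
  shows "integrable circle_measure H"
proof (rule Bochner_Integration.integrable_bound)
  show "integrable circle_measure (\<lambda>z. 1 + (norm (H z))\<^sup>2)"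
    using assms by (auto simp: L2_circle_def intro!: finite_measure.integrable_const finite_measure_circle)
  have "norm (H z) \<le> 1 + (norm (H z))\<^sup>2" for z
  proof -
    have "2 * norm (H z) \<le> 1 + (norm (H z))\<^sup>2"
      using zero_le_power2[of "norm (H z) - 1"] by (simp add: power2_diff)
    then show ?thesis using norm_ge_zero[of "H z"] by linarith
  qed
  then show "AE z in circle_measure. norm (H z) \<le> norm (1 + (norm (H z))\<^sup>2)"
    by (intro AE_I2) (smt (verit) real_norm_def)
qed (use assms in \<open>simp add: L2_circle_def\<close>)

lemma fourier_cnj:
  assumes "F \<in> borel_measurable circle_measure"
  shows "fourier (\<lambda>z. cnj (F z)) k = cnj (fourier F (- k))"
proof -
  have [measurable]: "F \<in> borel_measurable circle_measure" by fact
  have "fourier (\<lambda>z. cnj (F z)) k = (\<integral>z. z powi (- k) * cnj (F z) \<partial>circle_measure)"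
    by (rule fourier_eq_integral) (simp add: borel_measurable_cnj)
  also have "\<dots> = (\<integral>z. cnj (z powi k * F z) \<partial>circle_measure)"
    by (rule Bochner_Integration.integral_cong) (auto simp: cnj_powi_sphere simp del: complex_cnj_power_int)
  also have "\<dots> = cnj (\<integral>z. z powi k * F z \<partial>circle_measure)"
    by (rule Bochner_Integration.integral_cnj)
  finally show ?thesis
    using fourier_eq_integral[of F "-k"] by simp
qed


text \<open>Termwise integration is legitimate because the series of \<open>F\<close> is absolutely
  summable with moduli independent of the point: \<open>norm (H z)\<close> times a convergent
  constant dominates it. Only integrability of \<open>H\<close> enters, so the lemma serves both for
  \<open>H\<close> in H2 and for the conjugate of \<open>F\<close>.\<close>

lemma fourier_mult_has_sum:
  assumes F: "\<And>z. z \<in> sphere 0 1 \<Longrightarrow> ((\<lambda>n. c n * z powi n) has_sum F z) UNIV"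
    and c: "c summable_on UNIV" and Fm: "F \<in> borel_measurable circle_measure"
    and H: "integrable circle_measure H"
  shows "((\<lambda>n. c (x - n) * fourier H n) has_sum fourier (\<lambda>z. F z * H z) x) UNIV"
proof -
  let ?M = circle_measure
  \<comment> \<open>Termwise integration is about sequences, so the integers are enumerated; the
    reflection is chosen so that \<open>x - b i = int_decode i\<close>.\<close>
  define b where "b = (\<lambda>i. x - int_decode i)"
  have bij: "bij_betw b UNIV UNIV"
    unfolding b_def
    using bij_betw_comp_iff[of int_decode UNIV UNIV "\<lambda>n. x - n" UNIV] bij_int_decode
      bij_betwI[of "\<lambda>n. x - n" UNIV UNIV "\<lambda>n. x - n"]
    by (simp add: o_def)
  define g where "g i z = c (x - b i) * (z powi (- b i) * H z)" for i z
  have Hm [measurable]: "H \<in> borel_measurable ?M" using H by auto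
  have Fm' [measurable]: "F \<in> borel_measurable ?M" by fact
  have FH: "(\<lambda>z. F z * H z) \<in> borel_measurable ?M" by measurable
  have int: "integrable ?M (\<lambda>z. z powi k * H z)" for k
    by (rule integrable_powi_mult_circle[OF H])
  have cabs: "summable (\<lambda>i. norm (c (x - b i)))"
  proof -
    have "(\<lambda>n. norm (c n)) summable_on UNIV"
      using c summable_on_iff_abs_summable_on_complex by blast
    then have "(\<lambda>i. norm (c (int_decode i))) summable_on UNIV"
      using summable_on_reindex_bij_betw[OF bij_int_decode, of "\<lambda>n. norm (c n)"] by simp
    then show ?thesis
      using summable_on_imp_summable by (simp add: b_def)
  qed
  have sumg: "summable (\<lambda>i. norm (g i z))" if "z \<in> sphere 0 1" for z
    unfolding g_def using that summable_mult2[OF cabs, of "norm (H z)"]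
    by (simp add: norm_mult norm_power_int)
  have suminf_g: "(\<Sum>i. g i z) = z powi (- x) * (F z * H z)" if z: "z \<in> sphere 0 1" for z
  proof -
    have "((\<lambda>i. c (int_decode i) * z powi int_decode i) has_sum F z) UNIV"
      using has_sum_reindex_bij_betw[OF bij_int_decode, of "\<lambda>n. c n * z powi n"] F[OF z] by simp
    then have "(\<lambda>i. c (int_decode i) * z powi int_decode i) sums F z"
      by (rule has_sum_imp_sums)
    from sums_mult2[OF this, of "z powi (- x) * H z"]
    moreover have "c (int_decode i) * z powi int_decode i * (z powi (- x) * H z) = g i z" for i
      using powi_add_sphere[OF z, of "int_decode i" "- x"]
      by (simp add: g_def b_def mult_ac)
    ultimately have "(\<lambda>i. g i z) sums (F z * (z powi (- x) * H z))"
      by simp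
    then show ?thesis
      by (simp add: sums_iff mult_ac)
  qed
  have "(\<lambda>i. integral\<^sup>L ?M (g i)) sums (\<integral>z. (\<Sum>i. g i z) \<partial>?M)"
  proof (rule sums_integral)
    show "integrable ?M (g i)" for i
      unfolding g_def by (intro integrable_mult_right int)
    show "AE z in ?M. summable (\<lambda>i. norm (g i z))"
      by (rule AE_I2) (use sumg in auto)
    have "(\<integral>z. norm (g i z) \<partial>?M) = norm (c (x - b i)) * (\<integral>z. norm (H z) \<partial>?M)" for i
      unfolding g_def
      by (subst integral_mult_right_zero[symmetric], rule Bochner_Integration.integral_cong)
        (auto simp: norm_mult norm_power_int)
    then show "summable (\<lambda>i. \<integral>z. norm (g i z) \<partial>?M)"
      using summable_mult2[OF cabs, of "\<integral>z. norm (H z) \<partial>?M"] by simp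
  qed
  also have "(\<integral>z. (\<Sum>i. g i z) \<partial>?M) = (\<integral>z. z powi (- x) * (F z * H z) \<partial>?M)"
    by (rule Bochner_Integration.integral_cong) (auto simp: suminf_g)
  also have "\<dots> = fourier (\<lambda>z. F z * H z) x"
    by (rule fourier_eq_integral[symmetric, OF FH])
  also have "(\<lambda>i. integral\<^sup>L ?M (g i)) = (\<lambda>i. c (x - b i) * fourier H (b i))"
    by (simp add: g_def[abs_def] fourier_eq_integral[OF Hm])
  finally have sums: "(\<lambda>i. c (x - b i) * fourier H (b i)) sums fourier (\<lambda>z. F z * H z) x" .
  \<comment> \<open>Bounded coefficients make the enumerated series absolutely convergent, which
    allows the return to an unordered sum over the integers.\<close>
  have bound: "norm (fourier H n) \<le> (\<integral>z. norm (H z) \<partial>?M)" for n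
  proof -
    have "norm (fourier H n) \<le> (\<integral>z. norm (z powi (- n) * H z) \<partial>?M)"
      unfolding fourier_eq_integral[OF Hm] by (rule integral_norm_bound)
    also have "\<dots> = (\<integral>z. norm (H z) \<partial>?M)"
      by (rule Bochner_Integration.integral_cong) (auto simp: norm_mult norm_power_int)
    finally show ?thesis .
  qed
  have "summable (\<lambda>i. norm (c (x - b i) * fourier H (b i)))"
    by (rule summable_comparison_test'[OF summable_mult2[OF cabs, of "\<integral>z. norm (H z) \<partial>?M"]])
      (auto simp: norm_mult intro!: mult_left_mono bound)
  with sums have "((\<lambda>i. c (x - b i) * fourier H (b i)) has_sum fourier (\<lambda>z. F z * H z) x) UNIV"
    by (intro norm_summable_imp_has_sum)
  then show ?thesis
    using has_sum_reindex_bij_betw[OF bij, of "\<lambda>n. c (x - n) * fourier H n"] by simp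
qed

section \<open>Trigonometric polynomials, Bessel's inequality and the Riesz-Fischer theorem\<close>

lemma integral_cnj_trig_mult:
  assumes "finite A" "integrable circle_measure H"
  shows "(\<integral>z. cnj (\<Sum>k\<in>A. a k * z powi k) * H z \<partial>circle_measure) =
    (\<Sum>k\<in>A. cnj (a k) * fourier H k)"
proof -
  have Hm: "H \<in> borel_measurable circle_measure" using assms by auto
  have "(\<integral>z. cnj (\<Sum>k\<in>A. a k * z powi k) * H z \<partial>circle_measure) =
      (\<integral>z. (\<Sum>k\<in>A. cnj (a k) * (z powi (- k) * H z)) \<partial>circle_measure)"
    by (rule Bochner_Integration.integral_cong)
      (auto simp: sum_distrib_left sum_distrib_right cnj_powi_sphere mult_ac simp del: complex_cnj_power_int)
  also have "\<dots> = (\<Sum>k\<in>A. cnj (a k) * fourier H k)"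
    by (simp add: Bochner_Integration.integral_sum integrable_powi_mult_circle assms
        fourier_eq_integral[OF Hm])
  finally show ?thesis .
qed

lemma fourier_trig:
  assumes "finite A"
  shows "fourier (\<lambda>z. \<Sum>k\<in>A. a k * z powi k) n = (if n \<in> A then a n else 0)"
proof -
  have [measurable]: "(\<lambda>z. \<Sum>k\<in>A. a k * z powi k) \<in> borel_measurable circle_measure"
    by measurable
  have "z powi (- n) * (\<Sum>k\<in>A. a k * z powi k) = (\<Sum>k\<in>A. a k * z powi (k - n))"
    if "z \<in> sphere 0 1" for z
    unfolding sum_distrib_left
    by (intro sum.cong refl) (simp add: mult.left_commute powi_add_sphere[OF that])
  then have "fourier (\<lambda>z. \<Sum>k\<in>A. a k * z powi k) n =
      (\<integral>z. (\<Sum>k\<in>A. a k * z powi (k - n)) \<partial>circle_measure)"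
    by (subst fourier_eq_integral) (auto intro!: Bochner_Integration.integral_cong)
  also have "\<dots> = (\<Sum>k\<in>A. a k * (if k = n then 1 else 0))"
    by (simp add: Bochner_Integration.integral_sum integrable_powi_circle integral_powi_circle)
  also have "\<dots> = (if n \<in> A then a n else 0)"
    using assms by (simp add: if_distrib sum.delta cong: if_cong)
  finally show ?thesis .
qed

lemma integral_norm2_trig:
  assumes "finite A"
  shows "integrable circle_measure (\<lambda>z. \<Sum>k\<in>A. a k * z powi k)"
    and "integrable circle_measure (\<lambda>z. (norm (\<Sum>k\<in>A. a k * z powi k))\<^sup>2)"
    and "(\<integral>z. (norm (\<Sum>k\<in>A. a k * z powi k))\<^sup>2 \<partial>circle_measure) = (\<Sum>k\<in>A. (norm (a k))\<^sup>2)"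
proof -
  let ?p = "\<lambda>z. \<Sum>k\<in>A. a k * z powi k"
  show int: "integrable circle_measure ?p"
    by (intro Bochner_Integration.integrable_sum integrable_mult_right integrable_powi_circle)
  have "of_real ((norm (?p z))\<^sup>2) = cnj (?p z) * ?p z" for z
    by (subst complex_norm_square) (simp only: mult.commute)
  moreover have int2: "integrable circle_measure (\<lambda>z. cnj (?p z) * ?p z)"
  proof -
    have "integrable circle_measure (\<lambda>z. \<Sum>k\<in>A. cnj (a k) * (z powi (- k) * ?p z))"
      by (intro Bochner_Integration.integrable_sum integrable_mult_right integrable_powi_mult_circle int)
    then show ?thesis
      by (rule Bochner_Integration.integrable_cong[THEN iffD1, rotated -1])
        (auto simp: sum_distrib_left sum_distrib_right cnj_powi_sphere mult_ac simp del: complex_cnj_power_int)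
  qed
  ultimately have "integrable circle_measure (\<lambda>z. of_real ((norm (?p z))\<^sup>2) :: complex)"
    and I: "(\<integral>z. of_real ((norm (?p z))\<^sup>2) \<partial>circle_measure) = (\<integral>z. cnj (?p z) * ?p z \<partial>circle_measure)"
    by simp_all
  then show int3: "integrable circle_measure (\<lambda>z. (norm (?p z))\<^sup>2)"
    by (simp only: complex_of_real_integrable_eq)
  have "of_real (\<integral>z. (norm (?p z))\<^sup>2 \<partial>circle_measure) = (\<integral>z. cnj (?p z) * ?p z \<partial>circle_measure)"
    unfolding I[symmetric] by (rule integral_complex_of_real[symmetric])
  also have "\<dots> = (\<Sum>k\<in>A. cnj (a k) * fourier ?p k)"
    by (rule integral_cnj_trig_mult[OF assms int])
  also have "\<dots> = (\<Sum>k\<in>A. of_real ((norm (a k))\<^sup>2))"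
    by (rule sum.cong) (auto simp: fourier_trig[OF assms] complex_norm_square mult.commute simp del: of_real_power)
  also have "\<dots> = of_real (\<Sum>k\<in>A. (norm (a k))\<^sup>2)"
    by simp
  finally show "(\<integral>z. (norm (?p z))\<^sup>2 \<partial>circle_measure) = (\<Sum>k\<in>A. (norm (a k))\<^sup>2)"
    using of_real_eq_iff by blast
qed

text \<open>With p the partial Fourier sum, integrate |H - p|^2 \<ge> 0. The cross term and the
  square norm of p both equal the sum on the left, so what remains is the norm of \<open>H\<close>
  minus that sum.\<close>

lemma bessel_inequality:
  assumes H: "H \<in> L2_circle" and A: "finite A"
  shows "(\<Sum>k\<in>A. (norm (fourier H k))\<^sup>2) \<le> (\<integral>z. (norm (H z))\<^sup>2 \<partial>circle_measure)"
proof -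
  let ?M = circle_measure
  let ?p = "\<lambda>z. \<Sum>k\<in>A. fourier H k * z powi k"
  let ?S = "\<Sum>k\<in>A. (norm (fourier H k))\<^sup>2"
  have Hi: "integrable ?M H" by (rule L2_circle_integrable[OF H])
  have H2: "integrable ?M (\<lambda>z. (norm (H z))\<^sup>2)" using H by (simp add: L2_circle_def)
  note p = integral_norm2_trig[OF A, of "fourier H"]
  have pH: "integrable ?M (\<lambda>z. cnj (?p z) * H z)"
  proof -
    have "integrable ?M (\<lambda>z. \<Sum>k\<in>A. cnj (fourier H k) * (z powi (- k) * H z))"
      by (intro Bochner_Integration.integrable_sum integrable_mult_right integrable_powi_mult_circle Hi)
    then show ?thesis
      by (rule Bochner_Integration.integrable_cong[THEN iffD1, rotated -1])
        (auto simp: sum_distrib_left sum_distrib_right cnj_powi_sphere mult_ac simp del: complex_cnj_power_int)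
  qed
  have "(\<integral>z. cnj (?p z) * H z \<partial>?M) = (\<Sum>k\<in>A. of_real ((norm (fourier H k))\<^sup>2))"
    unfolding integral_cnj_trig_mult[OF A Hi]
    by (rule sum.cong) (auto simp: complex_norm_square mult.commute simp del: of_real_power)
  then have "Re (\<integral>z. cnj (?p z) * H z \<partial>?M) = ?S"
    by (simp add: Re_sum)
  then have Re: "(\<integral>z. Re (cnj (?p z) * H z) \<partial>?M) = ?S"
    using integral_Re[OF pH] by simp
  have pt: "0 \<le> (norm (H z))\<^sup>2 + (norm (?p z))\<^sup>2 - 2 * Re (cnj (?p z) * H z)" for z
  proof -
    have "(norm (w - p))\<^sup>2 = (norm w)\<^sup>2 + (norm p)\<^sup>2 - 2 * Re (cnj p * w)" for w p :: complex
      unfolding cmod_power2 by (simp add: power2_eq_square algebra_simps)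
    from this[of "H z" "?p z"] show ?thesis
      by (metis zero_le_power2)
  qed
  define q where "q z = Re (cnj (?p z) * H z)" for z
  have q: "integrable ?M q" "integral\<^sup>L ?M q = ?S"
    using integrable_Re[OF pH] Re unfolding q_def .
  have "0 \<le> (\<integral>z. (norm (H z))\<^sup>2 + (norm (?p z))\<^sup>2 - 2 * q z \<partial>?M)"
    using pt unfolding q_def by (intro Bochner_Integration.integral_nonneg) blast
  also have "\<dots> = (\<integral>z. (norm (H z))\<^sup>2 \<partial>?M) + ?S - 2 * ?S"
    using H2 p(2) q p(3) by simp
  finally show ?thesis by simp
qed

lemma fourier_L2_in_ell2:
  assumes "H \<in> L2_circle"
  shows "fourier H \<in> ell2"
  unfolding ell2_def mem_Collect_eq
  by (rule nonneg_bdd_above_summable_on)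
    (auto intro!: bdd_aboveI2[where M = "\<integral>z. (norm (H z))\<^sup>2 \<partial>circle_measure"] bessel_inequality[OF assms])

text \<open>Surjectivity onto \<open>ell2\<close>. It ensures that the coefficients of H2 functions
  fill the whole space of half-line sequences.\<close>

theorem riesz_fischer:
  assumes h: "h \<in> ell2"
  obtains H where "H \<in> L2_circle" "fourier H = h"
proof -
  let ?M = circle_measure
  define q where "q n = (norm (h n))\<^sup>2" for n
  have q: "q summable_on UNIV" using h by (simp add: ell2_def q_def[abs_def])
  have q0: "0 \<le> q n" for n by (simp add: q_def)
  have qfin: "sum q B \<le> infsum q UNIV" if "finite B" for B
    by (rule finite_sum_le_infsum) (use q q0 that in auto)
  txt \<open>Cut \<open>h\<close> into blocks \<open>D j\<close> of rapidly decreasing norm, so that the series of the corresponding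
    trigonometric polynomials converges absolutely in \<open>L\<^sup>1\<close>; its limit is in \<open>L\<^sup>2\<close> by Fatou.\<close>
  have "\<exists>A. finite A \<and> (\<forall>B. finite B \<longrightarrow> B \<inter> A = {} \<longrightarrow> sum q B \<le> (1/4) ^ j)" for j :: nat
  proof -
    obtain A where A: "finite A" "dist (sum q A) (infsum q UNIV) \<le> (1/4) ^ j"
      using infsum_finite_approximation[OF q, of "(1/4) ^ j"] by auto
    have "sum q B \<le> (1/4) ^ j" if "finite B" "B \<inter> A = {}" for B
      using qfin[of "A \<union> B"] A that sum.union_disjoint[of A B q]
      by (simp add: dist_real_def Int_commute)
    with A show ?thesis by blast
  qed
  then obtain A where A: "\<And>j. finite (A j)"
    "\<And>j B. finite B \<Longrightarrow> B \<inter> A j = {} \<Longrightarrow> sum q B \<le> (1/4) ^ j"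
    by metis
  \<comment> \<open>Removing the earlier sets keeps the union and makes the blocks disjoint; block
    \<open>Suc j\<close> also avoids \<open>A j\<close>, so its mass is at most
    \<open>(1/4) ^ j\<close>.\<close>
  define D where "D = disjointed A"
  have finD: "finite (D j)" for j
    using A(1) disjointed_subset[of A j] finite_subset unfolding D_def by blast
  have DA: "D (Suc j) \<inter> A j = {}" for j
    by (auto simp: D_def disjointed_def)
  have disjD: "i \<noteq> j \<Longrightarrow> D i \<inter> D j = {}" for i j
    using disjoint_family_disjointed[of A] by (auto simp: D_def disjoint_family_on_def)
  define g where "g j z = (\<Sum>k\<in>D j. h k * z powi k)" for j z
  note g = integral_norm2_trig[OF finD, of h, folded g_def]
  have gm [measurable]: "g j \<in> borel_measurable ?M" for j
    by (rule borel_measurable_integrable[OF g(1)])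
  have gn: "integrable ?M (\<lambda>z. norm (g j z))" for j
    using g(1) by (rule integrable_norm)
  have g1: "(\<integral>z. norm (g (Suc j) z) \<partial>?M) \<le> (1/2) ^ j" for j
  proof -
    \<comment> \<open>Arithmetic-geometric mean with weight \<open>2 ^ j\<close>: the constant,
      integrated over total mass one, and the square norm, at most \<open>(1/4) ^ j\<close>, then
      both contribute \<open>(1/2) ^ j\<close>.\<close>
    have amgm: "norm (g (Suc j) z) \<le> ((1/2) ^ j + 2 ^ j * (norm (g (Suc j) z))\<^sup>2) / 2" for z
    proof -
      define a where "a = norm (g (Suc j) z)"
      have "0 \<le> 2 ^ j * (a - (1/2) ^ j)\<^sup>2" by simp
      also have "\<dots> = 2 ^ j * a\<^sup>2 - 2 * a + (1/2) ^ j"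
        by (simp add: power2_eq_square algebra_simps power_divide)
      finally show ?thesis by (simp add: a_def)
    qed
    have "(\<integral>z. norm (g (Suc j) z) \<partial>?M) \<le>
        (\<integral>z. ((1/2) ^ j + 2 ^ j * (norm (g (Suc j) z))\<^sup>2) / 2 \<partial>?M)"
      using amgm
      by (intro integral_mono gn integrable_divide Bochner_Integration.integrable_add
          integrable_mult_right g(2) finite_measure.integrable_const finite_measure_circle)
    also have "\<dots> = ((1/2) ^ j + 2 ^ j * sum q (D (Suc j))) / 2"
      using g(2) by (simp add: g(3) q_def finite_measure.integrable_const[OF finite_measure_circle])
    also have "\<dots> \<le> ((1/2) ^ j + 2 ^ j * (1/4) ^ j) / 2"
      using A(2)[OF finD DA, of j] by simp
    also have "2 ^ j * (1/4) ^ j = (1/2 :: real) ^ j"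
      by (simp flip: power_mult_distrib)
    finally show ?thesis by simp
  qed
  have sum1: "summable (\<lambda>j. \<integral>z. norm (g j z) \<partial>?M)"
  proof -
    have "summable (\<lambda>j. \<integral>z. norm (g (Suc j) z) \<partial>?M)"
      by (rule summable_comparison_test'[of "\<lambda>j. (1/2) ^ j"])
        (auto intro!: g1 summable_geometric simp: integral_nonneg_AE)
    then show ?thesis
      using summable_Suc_iff[of "\<lambda>j. \<integral>z. norm (g j z) \<partial>?M"] by simp
  qed
  have AE: "AE z in ?M. summable (\<lambda>j. norm (g j z))"
  proof -
    have "(\<integral>\<^sup>+z. (\<Sum>j. ennreal (norm (g j z))) \<partial>?M) = (\<Sum>j. \<integral>\<^sup>+z. norm (g j z) \<partial>?M)"
      by (rule nn_integral_suminf) measurable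
    also have "\<dots> = (\<Sum>j. ennreal (\<integral>z. norm (g j z) \<partial>?M))"
      by (subst nn_integral_eq_integral[OF gn]) auto
    also have "\<dots> \<noteq> \<infinity>"
      using sum1 by (simp add: ennreal_suminf_neq_top integral_nonneg_AE)
    finally have "AE z in ?M. (\<Sum>j. ennreal (norm (g j z))) \<noteq> \<infinity>"
      by (intro nn_integral_PInf_AE) auto
    then show ?thesis
      by eventually_elim (auto intro: summable_suminf_not_top)
  qed
  \<comment> \<open>Where the series diverges, a null set by \<open>AE\<close>,
    \<open>suminf\<close> has an unspecified value that no integral sees.\<close>
  define H where "H z = (\<Sum>j. g j z)" for z
  have Hm [measurable]: "H \<in> borel_measurable ?M"
    unfolding H_def by measurable
  \<comment> \<open>Disjoint blocks merge into one trigonometric polynomial, whose square norm is a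
    finite partial sum of \<open>q\<close>; this gives the uniform bound for Fatou's lemma.\<close>
  have partial: "(\<Sum>j<J. g j z) = (\<Sum>k\<in>(\<Union>j<J. D j). h k * z powi k)" for J z
    unfolding g_def by (subst sum.UNION_disjoint) (use finD disjD in auto)
  have "H \<in> L2_circle"
  proof -
    have "(\<integral>\<^sup>+z. ennreal ((norm (H z))\<^sup>2) \<partial>?M) =
        (\<integral>\<^sup>+z. liminf (\<lambda>J. ennreal ((norm (\<Sum>j<J. g j z))\<^sup>2)) \<partial>?M)"
    proof (rule nn_integral_cong_AE)
      show "AE z in ?M. ennreal ((norm (H z))\<^sup>2) = liminf (\<lambda>J. ennreal ((norm (\<Sum>j<J. g j z))\<^sup>2))"
        using AE
      proof eventually_elim
        fix z assume "summable (\<lambda>j. norm (g j z))"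
        then have "(\<lambda>J. \<Sum>j<J. g j z) \<longlonglongrightarrow> H z"
          unfolding H_def by (rule summable_LIMSEQ[OF summable_norm_cancel])
        then have "(\<lambda>J. ennreal ((norm (\<Sum>j<J. g j z))\<^sup>2)) \<longlonglongrightarrow> ennreal ((norm (H z))\<^sup>2)"
          by (rule tendsto_ennrealI[OF tendsto_power[OF tendsto_norm]])
        then show "ennreal ((norm (H z))\<^sup>2) = liminf (\<lambda>J. ennreal ((norm (\<Sum>j<J. g j z))\<^sup>2))"
          by (rule lim_imp_Liminf[OF trivial_limit_sequentially, symmetric])
      qed
    qed
    also have "\<dots> \<le> liminf (\<lambda>J. \<integral>\<^sup>+z. ennreal ((norm (\<Sum>j<J. g j z))\<^sup>2) \<partial>?M)"
      by (rule nn_integral_liminf) measurable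
    also have "\<dots> \<le> ennreal (infsum q UNIV)"
    proof (rule Liminf_le)
      show "\<forall>\<^sub>F J in sequentially.
          (\<integral>\<^sup>+z. ennreal ((norm (\<Sum>j<J. g j z))\<^sup>2) \<partial>?M) \<le> ennreal (infsum q UNIV)"
      proof (rule always_eventually, rule allI)
        fix J
        let ?U = "\<Union>j<J. D j"
        have U: "finite ?U" using finD by auto
        show "(\<integral>\<^sup>+z. ennreal ((norm (\<Sum>j<J. g j z))\<^sup>2) \<partial>?M) \<le> ennreal (infsum q UNIV)"
          unfolding partial
          by (subst nn_integral_eq_integral[OF integral_norm2_trig(2)[OF U]])
            (use qfin[OF U] in \<open>auto simp: integral_norm2_trig(3)[OF U] q_def ennreal_leI\<close>)
      qed
    qed simp
    finally have "(\<integral>\<^sup>+z. ennreal ((norm (H z))\<^sup>2) \<partial>?M) < \<infinity>"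
      by (rule le_less_trans) simp
    then have "integrable ?M (\<lambda>z. (norm (H z))\<^sup>2)"
      by (intro integrableI_bounded) auto
    then show ?thesis
      by (simp add: L2_circle_def Hm)
  qed
  moreover have "fourier H = h"
  proof
    fix k
    have "(\<lambda>j. \<integral>z. z powi (- k) * g j z \<partial>?M) sums (\<integral>z. (\<Sum>j. z powi (- k) * g j z) \<partial>?M)"
    proof (rule sums_integral)
      show "integrable ?M (\<lambda>z. z powi (- k) * g j z)" for j
        by (rule integrable_powi_mult_circle[OF g(1)])
      have n: "norm (z powi (- k) * g j z) = norm (g j z)" if "z \<in> sphere 0 1" for j z
        using that by (simp add: norm_mult norm_power_int)
      show "AE z in ?M. summable (\<lambda>j. norm (z powi (- k) * g j z))"
        using AE AE_space by eventually_elim (simp add: n)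
      have "(\<integral>z. norm (z powi (- k) * g j z) \<partial>?M) = (\<integral>z. norm (g j z) \<partial>?M)" for j
        by (rule Bochner_Integration.integral_cong) (use n in auto)
      then show "summable (\<lambda>j. \<integral>z. norm (z powi (- k) * g j z) \<partial>?M)"
        using sum1 by simp
    qed
    also have "(\<integral>z. (\<Sum>j. z powi (- k) * g j z) \<partial>?M) = (\<integral>z. z powi (- k) * H z \<partial>?M)"
    proof (rule integral_cong_AE)
      show "AE z in ?M. (\<Sum>j. z powi (- k) * g j z) = z powi (- k) * H z"
        using AE by eventually_elim (auto simp: H_def intro!: suminf_mult summable_norm_cancel)
    qed measurable
    also have "\<dots> = fourier H k"
      by (rule fourier_eq_integral[OF Hm, symmetric])
    also have "(\<lambda>j. \<integral>z. z powi (- k) * g j z \<partial>?M) = (\<lambda>j. if k \<in> D j then h k else 0)"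
      using fourier_trig[OF finD, of h, folded g_def] by (simp add: fourier_eq_integral[OF gm])
    finally have s: "(\<lambda>j. if k \<in> D j then h k else 0) sums fourier H k" .
    show "fourier H k = h k"
    proof (cases "\<exists>j. k \<in> D j")
      case True
      then obtain i where i: "k \<in> D i" ..
      then have "(\<lambda>j. if k \<in> D j then h k else 0) = (\<lambda>j. if j = i then h k else 0)"
        using disjD by fastforce
      then show ?thesis
        using s sums_single[of i "\<lambda>_. h k"] by (metis sums_unique2)
    next
      \<comment> \<open>A frequency outside every \<open>A j\<close> obeys the tail bound at every
        level, which forces its coefficient to vanish.\<close>
      case False
      then have "k \<notin> (\<Union>j. A j)"
        using UN_disjointed_eq[of A] unfolding D_def by blast
      then have "q k \<le> (1/4) ^ j" for j
        using A(2)[of "{k}" j] by auto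
      then have "q k \<le> 0"
        by (intro LIMSEQ_le_const[OF LIMSEQ_power_zero]) auto
      then have "h k = 0" by (simp add: q_def)
      with False s show ?thesis by (simp add: sums_iff)
    qed
  qed
  ultimately show ?thesis by (rule that)
qed

section \<open>Laurent series on an annulus\<close>

lemma open_annulus: "open {z :: 'a :: real_normed_vector. a < norm z \<and> norm z < b}"
proof -
  have "{z::'a. a < norm z \<and> norm z < b} = norm -` {a<..<b}" by auto
  then show ?thesis
    by (simp add: open_vimage continuous_on_norm_id)
qed

text \<open>The linear homotopy joins points of equal argument, hence moves along radii and never
  leaves the annulus.\<close>

lemma contour_integral_circlepath_annulus:
  assumes f: "f holomorphic_on {z. a < norm z \<and> norm z < b}"
    and r: "0 < r" "a < r" "r < b" and s: "0 < s" "a < s" "s < b"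
  shows "contour_integral (circlepath 0 r) f = contour_integral (circlepath 0 s) f"
proof (rule Cauchy_theorem_homotopic_loops)
  show "homotopic_loops {z. a < norm z \<and> norm z < b} (circlepath 0 r) (circlepath 0 s)"
  proof (rule homotopic_loops_linear)
    fix t :: real
    let ?e = "exp (2 * of_real pi * \<i> * of_real t)"
    have e: "norm ?e = 1" by (simp add: norm_exp_eq_Re)
    show "closed_segment (circlepath 0 r t) (circlepath 0 s t) \<subseteq> {z. a < norm z \<and> norm z < b}"
    proof
      fix z assume "z \<in> closed_segment (circlepath 0 r t) (circlepath 0 s t)"
      then obtain u where u: "0 \<le> u" "u \<le> 1"
        "z = (1 - u) *\<^sub>R (of_real r * ?e) + u *\<^sub>R (of_real s * ?e)"
        by (auto simp: closed_segment_def circlepath)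
      define c where "c = (1 - u) * r + u * s"
      have "z = of_real c * ?e"
        by (simp add: u(3) c_def scaleR_conv_of_real algebra_simps)
      then have "norm z = \<bar>c\<bar>" by (simp add: norm_mult e)
      \<comment> \<open>Positivity gives \<open>\<bar>c\<bar> = c\<close>; the maximum is taken
        because \<open>a\<close> may be negative here.\<close>
      moreover have "c \<in> {max 0 a<..<b}"
        unfolding c_def real_scaleR_def[symmetric]
        by (rule convexD[OF convex_real_interval(8)]) (use u r s in auto)
      ultimately show "z \<in> {z. a < norm z \<and> norm z < b}" by auto
    qed
  qed auto
qed (use f in \<open>auto simp: open_annulus\<close>)

lemma fourier_eq_contour_integral:
  assumes "continuous_on (sphere 0 1) f"
  shows "contour_integral (circlepath 0 1) (\<lambda>z. f z * z powi (- k - 1)) =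
    2 * of_real pi * \<i> * fourier f k"
proof -
  let ?g = "\<lambda>z. f z * z powi (- k - 1)"
  \<comment> \<open>\<open>[-\<pi>, \<pi>]\<close> parametrizes the circle from \<open>-1\<close>, whereas \<^const>\<open>circlepath\<close> starts at \<open>1\<close>.\<close>
  have sh: "contour_integral (shiftpath (1/2) (circlepath 0 1)) ?g = contour_integral (circlepath 0 1) ?g"
    by (rule contour_integral_shiftpath) auto
  have cf: "continuous_on {-pi..pi} (\<lambda>t. f (cis t) * cis t powi (- k))"
    by (intro continuous_intros continuous_on_compose2[OF assms]) auto
  \<comment> \<open>The derivative of the parametrization supplies a factor z, which absorbs the
    \<open>- 1\<close> in the exponent.\<close>
  have eq: "f (cis t) * cis t powi (- k - 1) * \<i> * cis t =
      \<i> * (f (cis t) * cis t powi (- k))" for t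
    by (simp add: power_int_diff)
  have "contour_integral (part_circlepath 0 1 (- pi) pi) ?g =
      integral {-pi..pi} (\<lambda>t. ?g (0 + of_real 1 * cis t) * of_real 1 * \<i> * cis t)"
    by (rule contour_integral_part_circlepath_eq) simp
  also have "\<dots> = \<i> * integral {-pi..pi} (\<lambda>t. f (cis t) * cis t powi (- k))"
    by (simp add: eq)
  also have "integral {-pi..pi} (\<lambda>t. f (cis t) * cis t powi (- k)) =
      (LBINT t:{-pi..pi}. f (cis t) * cis t powi (- k))"
    by (rule set_borel_integral_eq_integral(2)[symmetric])
      (rule borel_integrable_atLeastAtMost'[OF cf])
  also have "(LBINT t:{-pi..pi}. f (cis t) * cis t powi (- k)) = 2 * of_real pi * fourier f k"
    by (simp add: fourier_def cis_conv_exp exp_power_int mult_ac)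
  also have "contour_integral (part_circlepath 0 1 (- pi) pi) ?g = contour_integral (circlepath 0 1) ?g"
  proof -
    have "part_circlepath 0 1 (- pi) pi = shiftpath (1/2) (circlepath 0 1)"
    proof
      fix x :: real
      \<comment> \<open>Starting at angle -pi multiplies the standard parametrization by -1, that
        is, gives it the radius -1.\<close>
      have "part_circlepath 0 1 (- pi) pi x = circlepath 0 (- 1) x"
        by (simp add: part_circlepath_def linepath_def circlepath scaleR_conv_of_real
            algebra_simps exp_add exp_diff exp_minus)
      also have "\<dots> = shiftpath (1/2) (circlepath 0 1) x"
        using circlepath_add_half[of 0 1 x] by (simp add: circlepath_minus shiftpath_def add.commute)
      finally show "part_circlepath 0 1 (- pi) pi x = shiftpath (1/2) (circlepath 0 1) x" .
    qed
    with sh show ?thesis by simp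
  qed
  finally show ?thesis by (simp add: mult_ac)
qed

lemma fourier_eq_contour_integral_annulus:
  assumes f: "f holomorphic_on {z. a < norm z \<and> norm z < b}"
    and ab: "a < 1" "1 < b" and r: "0 < r" "a < r" "r < b"
  shows "contour_integral (circlepath 0 r) (\<lambda>z. f z * z powi (- k - 1)) =
    2 * of_real pi * \<i> * fourier f k"
proof -
  \<comment> \<open>Taking the maximum with 0 keeps out the origin, where the power may have a
    pole.\<close>
  have f': "(\<lambda>z. f z * z powi (- k - 1)) holomorphic_on {z. max 0 a < norm z \<and> norm z < b}"
    by (intro holomorphic_intros holomorphic_on_subset[OF f]) auto
  have "continuous_on (sphere 0 1) f"
    by (rule continuous_on_subset[OF holomorphic_on_imp_continuous_on[OF f]]) (use ab in auto)
  from fourier_eq_contour_integral[OF this, of k]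
  show ?thesis
    using contour_integral_circlepath_annulus[OF f', of r 1] ab r by simp
qed

lemma contour_integral_circlepath_sums:
  assumes r: "0 < r"
    and f: "\<And>n. continuous_on (sphere 0 r) (f n)"
    and bound: "\<And>n z. z \<in> sphere 0 r \<Longrightarrow> norm (f n z) \<le> M n" and M: "summable M"
    and F: "\<And>z. z \<in> sphere 0 r \<Longrightarrow> (\<lambda>n. f n z) sums F z"
  shows "(\<lambda>n. contour_integral (circlepath 0 r) (f n)) sums contour_integral (circlepath 0 r) F"
proof -
  have int: "f n contour_integrable_on circlepath 0 r" for n
    using f r by (intro contour_integrable_continuous_circlepath) simp
  have ul: "uniform_limit (sphere 0 r) (\<lambda>N z. \<Sum>n<N. f n z) (\<lambda>z. \<Sum>n. f n z) sequentially"
    by (rule Weierstrass_m_test[OF bound M])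
  have ul': "uniform_limit (sphere 0 r) (\<lambda>N z. \<Sum>n<N. f n z) F sequentially"
    by (rule uniform_limit_cong'[THEN iffD1, OF _ _ ul]) (use F in \<open>auto simp: sums_iff\<close>)
  have "(\<lambda>N. contour_integral (circlepath 0 r) (\<lambda>z. \<Sum>n<N. f n z)) \<longlonglongrightarrow>
      contour_integral (circlepath 0 r) F"
    by (rule contour_integral_uniform_limit_circlepath[OF _ ul'])
      (use int r in \<open>auto intro!: always_eventually contour_integrable_sum\<close>)
  then show ?thesis
    by (simp add: sums_def contour_integral_sum int)
qed


section \<open>Geometric expansion of the Cauchy kernel and the Laurent series\<close>

lemma contour_integral_cmult:
  "contour_integral g (\<lambda>z. c * f z) = c * contour_integral g f"
  "contour_integral g (\<lambda>z. f z * c) = contour_integral g f * c"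
  by (simp_all add: contour_integral_integral mult.assoc mult.commute[of _ c])

text \<open>The ratio \<open>w / z\<close> has constant modulus \<open>s / norm z\<close> < 1 on the
  circle, so the geometric series converges uniformly there. This expansion yields the negative half
  of the Laurent series and, later, the inner integral of the Schur kernel.\<close>

lemma contour_integral_cauchy_kernel_inner:
  assumes s: "0 < s" and f: "continuous_on (sphere 0 s) f" and z: "s < norm z"
  shows "(\<lambda>n. contour_integral (circlepath 0 s) (\<lambda>w. f w * w ^ n) * (1 / z ^ Suc n)) sums
    contour_integral (circlepath 0 s) (\<lambda>w. f w / (z - w))"
proof -
  obtain B where B: "\<And>w. w \<in> sphere 0 s \<Longrightarrow> norm (f w) \<le> B"
    using compact_imp_bounded[OF compact_continuous_image[OF f compact_sphere]]
    unfolding bounded_iff by blast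
  have z0: "z \<noteq> 0" using s z by auto
  have "(\<lambda>n. contour_integral (circlepath 0 s) (\<lambda>w. f w * w ^ n * (1 / z ^ Suc n))) sums
    contour_integral (circlepath 0 s) (\<lambda>w. f w / (z - w))"
  proof (rule contour_integral_circlepath_sums[OF s])
    show "continuous_on (sphere 0 s) (\<lambda>w. f w * w ^ n * (1 / z ^ Suc n))" for n
      by (intro continuous_intros f) (use z0 in auto)
    show "norm (f w * w ^ n * (1 / z ^ Suc n)) \<le> B / norm z * (s / norm z) ^ n"
      if "w \<in> sphere 0 s" for n w
    proof -
      have "norm (f w * w ^ n * (1 / z ^ Suc n)) = norm (f w) * (s ^ n / norm z ^ Suc n)"
        using that by (simp add: norm_mult norm_power norm_divide)
      also have "\<dots> \<le> B * (s ^ n / norm z ^ Suc n)"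
        by (rule mult_right_mono[OF B[OF that]]) (use s in auto)
      finally show ?thesis by (simp add: power_divide)
    qed
    show "summable (\<lambda>n. B / norm z * (s / norm z) ^ n)"
      by (intro summable_mult summable_geometric) (use s z in \<open>simp add: divide_less_eq\<close>)
    show "(\<lambda>n. f w * w ^ n * (1 / z ^ Suc n)) sums (f w / (z - w))" if "w \<in> sphere 0 s" for w
    proof -
      have "norm (w / z) < 1" using that s z by (simp add: norm_divide divide_less_eq)
      from sums_mult[OF geometric_sums[OF this], of "f w / z"]
      have "(\<lambda>n. f w / z * (w / z) ^ n) sums (f w / z * (1 / (1 - w / z)))" .
      moreover have "f w / z * (1 / (1 - w / z)) = f w / (z - w)"
        using z0 by (simp add: right_diff_distrib)
      moreover have "f w / z * (w / z) ^ n = f w * w ^ n * (1 / z ^ Suc n)" for n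
        by (simp add: power_divide)
      ultimately show ?thesis by (simp only:)
    qed
  qed
  then show ?thesis by (simp only: contour_integral_cmult)
qed

lemma contour_integral_cauchy_kernel_outer:
  assumes r: "0 < r" and f: "continuous_on (sphere 0 r) f" and z: "norm z < r"
  shows "(\<lambda>n. contour_integral (circlepath 0 r) (\<lambda>w. f w / w ^ Suc n) * z ^ n) sums
    contour_integral (circlepath 0 r) (\<lambda>w. f w / (w - z))"
proof -
  obtain B where B: "\<And>w. w \<in> sphere 0 r \<Longrightarrow> norm (f w) \<le> B"
    using compact_imp_bounded[OF compact_continuous_image[OF f compact_sphere]]
    unfolding bounded_iff by blast
  have "(\<lambda>n. contour_integral (circlepath 0 r) (\<lambda>w. f w / w ^ Suc n * z ^ n)) sums
    contour_integral (circlepath 0 r) (\<lambda>w. f w / (w - z))"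
  proof (rule contour_integral_circlepath_sums[OF r])
    show "continuous_on (sphere 0 r) (\<lambda>w. f w / w ^ Suc n * z ^ n)" for n
      by (intro continuous_intros f) (use r in auto)
    show "norm (f w / w ^ Suc n * z ^ n) \<le> B / r * (norm z / r) ^ n"
      if "w \<in> sphere 0 r" for n w
    proof -
      have "norm (f w / w ^ Suc n * z ^ n) = norm (f w) * (norm z ^ n / r ^ Suc n)"
        using that by (simp add: norm_mult norm_power norm_divide)
      also have "\<dots> \<le> B * (norm z ^ n / r ^ Suc n)"
        by (rule mult_right_mono[OF B[OF that]]) (use r in auto)
      finally show ?thesis by (simp add: power_divide)
    qed
    show "summable (\<lambda>n. B / r * (norm z / r) ^ n)"
      by (intro summable_mult summable_geometric) (use r z in auto)
    show "(\<lambda>n. f w / w ^ Suc n * z ^ n) sums (f w / (w - z))" if "w \<in> sphere 0 r" for w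
    proof -
      have w0: "w \<noteq> 0" using that r by auto
      have "norm (z / w) < 1" using that r z by (simp add: norm_divide divide_less_eq)
      from sums_mult[OF geometric_sums[OF this], of "f w / w"]
      have "(\<lambda>n. f w / w * (z / w) ^ n) sums (f w / w * (1 / (1 - z / w)))" .
      moreover have "f w / w * (1 / (1 - z / w)) = f w / (w - z)"
        using w0 by (simp add: right_diff_distrib)
      moreover have "f w / w * (z / w) ^ n = f w / w ^ Suc n * z ^ n" for n
        by (simp add: power_divide)
      ultimately show ?thesis by (simp only:)
    qed
  qed
  then show ?thesis by (simp only: contour_integral_cmult)
qed

text \<open>In Cauchy's formula for an annulus the outer circle produces the nonnegative powers and
  the inner circle the negative ones. The first half is stated as convergence to its own
  \<open>suminf\<close>, because only the total of both halves is known; the second half carries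
  what is left of \<open>f z\<close>.\<close>

lemma fourier_series_annulus:
  assumes f: "f holomorphic_on {z. a < norm z \<and> norm z < b}"
    and ab: "0 \<le> a" "a < 1" "1 < b" and z: "a < norm z" "norm z < b"
  shows "(\<lambda>n. fourier f (int n) * z powi int n) sums (\<Sum>n. fourier f (int n) * z powi int n)" (is ?p)
    and "(\<lambda>n. fourier f (- int (Suc n)) * z powi (- int (Suc n))) sums
      (f z - (\<Sum>n. fourier f (int n) * z powi int n))" (is ?n)
proof -
  let ?A = "{z. a < norm z \<and> norm z < b}"
  obtain r where r: "norm z < r" "r < b" using z dense by blast
  obtain s where s: "a < s" "s < norm z" using z dense by blast
  have s0: "0 < s" and r0: "0 < r" using s r ab z by auto
  have cont: "continuous_on (sphere 0 t) f" if "a < t" "t < b" for t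
    by (rule continuous_on_subset[OF holomorphic_on_imp_continuous_on[OF f]])
      (use that ab in auto)
  define I where "I t h = contour_integral (circlepath 0 t) h" for t and h :: "complex \<Rightarrow> complex"
  \<comment> \<open>The difference quotient, completed by the derivative, is holomorphic across
    \<open>z\<close>, so its integrals over the circles on either side of \<open>z\<close> agree.
    Splitting them leaves one full residue from the outer circle and none from the inner
    one.\<close>
  define q where "q w = (if w = z then deriv f z else (f w - f z) / (w - z))" for w
  have q: "q holomorphic_on ?A"
    unfolding q_def by (rule pole_lemma_open[OF f open_annulus])
  have rs: "I r q = I s q"
    unfolding I_def by (rule contour_integral_circlepath_annulus[OF q]) (use r s s0 r0 z in auto)
  have I_q: "I t q = I t (\<lambda>w. f w / (w - z)) - f z * I t (\<lambda>w. 1 / (w - z))"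
    if "a < t" "t < b" "t \<noteq> norm z" for t
  proof -
    have t0: "0 < t" using that ab by simp
    have nz: "w \<noteq> z" if "w \<in> sphere 0 t" for w using that \<open>t \<noteq> norm z\<close> t0 by auto
    have "I t q = I t (\<lambda>w. f w / (w - z) - f z * (1 / (w - z)))"
      unfolding I_def
      by (rule contour_integral_eq) (use nz t0 in \<open>auto simp: q_def diff_divide_distrib\<close>)
    also have "\<dots> = I t (\<lambda>w. f w / (w - z)) - I t (\<lambda>w. f z * (1 / (w - z)))"
      unfolding I_def
      by (rule contour_integral_diff; rule contour_integrable_continuous_circlepath)
        (use nz t0 cont[OF that(1,2)] in \<open>auto intro!: continuous_intros\<close>)
    finally show ?thesis by (simp only: I_def contour_integral_cmult)
  qed
  have Ir: "I r (\<lambda>w. 1 / (w - z)) = 2 * of_real pi * \<i>"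
  proof -
    have "((\<lambda>w. 1 / (w - z)) has_contour_integral (2 * of_real pi * \<i> * 1)) (circlepath 0 r)"
      by (rule Cauchy_integral_circlepath_simple[where f = "\<lambda>_. 1"]) (use r in auto)
    then show ?thesis by (simp add: I_def contour_integral_unique)
  qed
  have Is: "I s (\<lambda>w. 1 / (w - z)) = 0"
  proof -
    have "((\<lambda>w. 1 / (w - z)) has_contour_integral 0) (circlepath 0 s)"
      by (rule Cauchy_theorem_disc_simple[of _ 0 "norm z"])
        (use s s0 in \<open>auto intro!: holomorphic_intros\<close>)
    then show ?thesis by (simp add: I_def contour_integral_unique)
  qed
  have neg_I: "I s (\<lambda>w. f w / (z - w)) = - I s (\<lambda>w. f w / (w - z))"
  proof -
    have "(\<lambda>w. f w / (z - w)) = (\<lambda>w. - (f w / (w - z)))"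
      by (simp add: fun_eq_iff minus_divide_right)
    then show ?thesis by (simp add: I_def contour_integral_neg)
  qed
  have cauchy: "2 * of_real pi * \<i> * f z =
      I r (\<lambda>w. f w / (w - z)) + I s (\<lambda>w. f w / (z - w))"
  proof -
    have "I r (\<lambda>w. f w / (w - z)) - f z * (2 * of_real pi * \<i>) = I s (\<lambda>w. f w / (w - z))"
      using rs I_q[of r] I_q[of s] r s z by (simp add: Ir Is)
    then show ?thesis unfolding neg_I by (simp add: algebra_simps)
  qed
  have coeff: "I t (\<lambda>w. f w * w powi (- k - 1)) = 2 * of_real pi * \<i> * fourier f k"
    if "a < t" "t < b" for k t
    unfolding I_def by (rule fourier_eq_contour_integral_annulus[OF f]) (use that ab in auto)
  have "(\<lambda>n. I r (\<lambda>w. f w / w ^ Suc n) * z ^ n) sums I r (\<lambda>w. f w / (w - z))"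
    unfolding I_def
    by (rule contour_integral_cauchy_kernel_outer[OF r0 cont]) (use r z in auto)
  moreover have "I r (\<lambda>w. f w / w ^ Suc n) * z ^ n =
      2 * of_real pi * \<i> * (fourier f (int n) * z powi int n)" for n
  proof -
    have "w powi (- int n - 1) = inverse (w ^ Suc n)" for w :: complex
    proof -
      have "- int n - 1 = - int (Suc n)" by simp
      then show ?thesis by (simp only: power_int_minus power_int_of_nat)
    qed
    then have "I r (\<lambda>w. f w / w ^ Suc n) = I r (\<lambda>w. f w * w powi (- int n - 1))"
      by (simp add: divide_inverse)
    then show ?thesis using coeff[of r "int n"] r z by simp
  qed
  ultimately have "(\<lambda>n. 2 * of_real pi * \<i> * (fourier f (int n) * z powi int n)) sums
      I r (\<lambda>w. f w / (w - z))" by (simp only:)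
  from sums_divide[OF this, of "2 * of_real pi * \<i>"]
  have pos: "(\<lambda>n. fourier f (int n) * z powi int n) sums
      (I r (\<lambda>w. f w / (w - z)) / (2 * of_real pi * \<i>))" by simp
  then show ?p by (simp add: sums_iff)
  have "(\<lambda>n. I s (\<lambda>w. f w * w ^ n) * (1 / z ^ Suc n)) sums I s (\<lambda>w. f w / (z - w))"
    unfolding I_def
    by (rule contour_integral_cauchy_kernel_inner[OF s0 cont]) (use s z in auto)
  moreover have "I s (\<lambda>w. f w * w ^ n) * (1 / z ^ Suc n) =
      2 * of_real pi * \<i> * (fourier f (- int (Suc n)) * z powi (- int (Suc n)))" for n
  proof -
    have "1 / z ^ Suc n = z powi (- int (Suc n))"
      by (simp only: power_int_minus power_int_of_nat divide_inverse mult_1)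
    then show ?thesis using coeff[of s "- int (Suc n)"] s z by simp
  qed
  ultimately have "(\<lambda>n. 2 * of_real pi * \<i> * (fourier f (- int (Suc n)) * z powi (- int (Suc n)))) sums
      I s (\<lambda>w. f w / (z - w))" by (simp only:)
  from sums_divide[OF this, of "2 * of_real pi * \<i>"]
  have neg: "(\<lambda>n. fourier f (- int (Suc n)) * z powi (- int (Suc n))) sums
      (I s (\<lambda>w. f w / (z - w)) / (2 * of_real pi * \<i>))" by simp
  have "I s (\<lambda>w. f w / (z - w)) / (2 * of_real pi * \<i>) =
      f z - (\<Sum>n. fourier f (int n) * z powi int n)"
    using cauchy pos by (simp add: sums_iff field_simps)
  with neg show ?n by simp
qed


lemma has_sum_int_split:
  fixes f :: "int \<Rightarrow> 'a :: banach"
  assumes "(\<lambda>n. f (int n)) sums s" "summable (\<lambda>n. norm (f (int n)))"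
    and "(\<lambda>n. f (- int (Suc n))) sums t" "summable (\<lambda>n. norm (f (- int (Suc n))))"
  shows "(f has_sum (s + t)) UNIV"
proof -
  have 1: "(f has_sum s) {0..}"
  proof -
    have "((\<lambda>n. f (int n)) has_sum s) UNIV"
      by (rule norm_summable_imp_has_sum) fact+
    also have "?this \<longleftrightarrow> (f has_sum s) {0..}"
      by (rule has_sum_reindex_bij_witness[of _ nat int]) auto
    finally show ?thesis .
  qed
  have 2: "(f has_sum t) {..<0}"
  proof -
    have "((\<lambda>n. f (- int (Suc n))) has_sum t) UNIV"
      by (rule norm_summable_imp_has_sum) fact+
    also have "?this \<longleftrightarrow> (f has_sum t) {..<0}"
      by (rule has_sum_reindex_bij_witness[of _ "\<lambda>k. nat (- k - 1)" "\<lambda>n. - int (Suc n)"]) auto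
    finally show ?thesis .
  qed
  have "{0::int..} \<union> {..<0} = UNIV" by auto
  moreover have "{0::int..} \<inter> {..<0} = {}" by auto
  ultimately show ?thesis using has_sum_Un_disjoint[OF 1 2] by simp
qed

text \<open>Unordered summation requires absolute convergence. It follows from plain convergence at
  a slightly larger radius for the nonnegative powers and at a slightly smaller one for the negative
  powers.\<close>

lemma fourier_has_sum_annulus:
  assumes f: "f holomorphic_on {z. a < norm z \<and> norm z < b}"
    and ab: "0 \<le> a" "a < 1" "1 < b" and z: "a < norm z" "norm z < b"
  shows "((\<lambda>k. fourier f k * z powi k) has_sum f z) UNIV"
proof -
  note series = fourier_series_annulus[OF f ab]
  obtain r where r: "norm z < r" "r < b" using z dense by blast
  obtain s where s: "a < s" "s < norm z" using z dense by blast
  have "summable (\<lambda>n. fourier f (int n) * of_real r ^ n)"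
    using series(1)[of "of_real r"] r z ab by (simp add: sums_iff)
  then have 1: "summable (\<lambda>n. norm (fourier f (int n) * z ^ n))"
    by (rule powser_insidea) (use r in auto)
  have inv: "w powi (- int (Suc n)) = inverse w ^ n * inverse w" for w :: complex and n
    using power_int_minus[of w "int (Suc n)"] by (simp only: power_int_of_nat) (simp add: power_inverse)
  have "summable (\<lambda>n. fourier f (- int (Suc n)) * (inverse (of_real s) ^ n * inverse (of_real s)))"
    using series(2)[of "of_real s"] s z ab unfolding inv by (simp add: sums_iff)
  from summable_mult[OF this, of "of_real s"]
  have "summable (\<lambda>n. fourier f (- int (Suc n)) * inverse (of_real s) ^ n)"
    using s ab by (simp add: field_simps)
  then have "summable (\<lambda>n. norm (fourier f (- int (Suc n)) * inverse z ^ n))"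
    by (rule powser_insidea) (use s ab in \<open>auto simp: norm_inverse intro!: less_imp_inverse_less\<close>)
  from summable_mult[OF this, of "norm (inverse z)"]
  have 2: "summable (\<lambda>n. norm (fourier f (- int (Suc n)) * z powi (- int (Suc n))))"
    unfolding inv by (simp add: norm_mult mult_ac)
  show ?thesis
    using has_sum_int_split[OF series(1)[OF z] _ series(2)[OF z]] 1 2 by simp
qed

section \<open>Convolution operators and projections\<close>

definition conv :: "(int \<Rightarrow> complex) \<Rightarrow> (int \<Rightarrow> complex) \<Rightarrow> int \<Rightarrow> complex" where
  "conv c f x = (\<Sum>\<^sub>\<infinity>n. c (x - n) * f n)"

text \<open>Convolution with this sequence is the adjoint of convolution with \<open>c\<close>; in
  terms of functions it belongs to the complex conjugate.\<close>

definition conv_adj :: "(int \<Rightarrow> complex) \<Rightarrow> int \<Rightarrow> complex" where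
  "conv_adj c n = cnj (c (- n))"

lemma norm_summable_complex:
  fixes f :: "'a \<Rightarrow> complex"
  shows "(\<lambda>n. norm (f n)) summable_on A \<longleftrightarrow> f summable_on A"
  using summable_on_iff_abs_summable_on_complex[of f A] by simp

lemma summable_on_shift:
  fixes x :: int
  shows "(\<lambda>n. f (n - x)) summable_on UNIV \<longleftrightarrow> f summable_on UNIV"
    and "(\<lambda>n. f (x - n)) summable_on UNIV \<longleftrightarrow> f summable_on UNIV"
  by (rule summable_on_reindex_bij_witness[of _ "\<lambda>n. n + x" "\<lambda>n. n - x"]; simp)
    (rule summable_on_reindex_bij_witness[of _ "\<lambda>n. x - n" "\<lambda>n. x - n"]; simp)

lemma infsum_shift:
  fixes x :: int
  shows "(\<Sum>\<^sub>\<infinity>n. f (n - x)) = infsum f UNIV" and "(\<Sum>\<^sub>\<infinity>n. f (x - n)) = infsum f UNIV"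
  by (rule infsum_reindex_bij_witness[of _ "\<lambda>n. n + x" "\<lambda>n. n - x"]; simp)
    (rule infsum_reindex_bij_witness[of _ "\<lambda>n. x - n" "\<lambda>n. x - n"]; simp)

lemma summable_conv_adj:
  assumes "c summable_on UNIV"
  shows "conv_adj c summable_on UNIV"
proof -
  have "(\<lambda>n. c (0 - n)) summable_on UNIV"
    using assms by (simp only: summable_on_shift)
  then show ?thesis
    unfolding conv_adj_def[abs_def] by simp
qed

section \<open>Absolutely summable sequences acting on l2 by convolution\<close>

lemma ell2_bounded:
  assumes "f \<in> ell2"
  obtains B where "\<And>n. norm (f n) \<le> B"
proof
  fix n
  have "(norm (f n))\<^sup>2 \<le> (\<Sum>\<^sub>\<infinity>n. (norm (f n))\<^sup>2)"
    using finite_sum_le_infsum[of "\<lambda>n. (norm (f n))\<^sup>2" UNIV "{n}"] assms by (simp add: ell2_def)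
  then show "norm (f n) \<le> sqrt (\<Sum>\<^sub>\<infinity>n. (norm (f n))\<^sup>2)"
    by (rule real_le_rsqrt)
qed

lemma summable_mult_bounded:
  fixes c f :: "'a \<Rightarrow> complex"
  assumes "c summable_on A" "\<And>n. norm (f n) \<le> B"
  shows "(\<lambda>n. c n * f n) summable_on A"
proof -
  have "(\<lambda>n. norm (c n) * B) summable_on A"
    using assms(1) by (intro summable_on_cmult_left) (simp add: norm_summable_complex)
  then have "(\<lambda>n. norm (c n * f n)) summable_on A"
    by (rule summable_on_comparison_test) (auto simp: norm_mult intro!: mult_left_mono assms(2))
  then show ?thesis by (simp add: norm_summable_complex)
qed

lemma summable_conv:
  fixes c f :: "int \<Rightarrow> complex"
  assumes "c summable_on UNIV" "\<And>n. norm (f n) \<le> B"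
  shows "(\<lambda>n. c (x - n) * f n) summable_on UNIV"
  by (rule summable_mult_bounded[OF _ assms(2)]) (simp only: summable_on_shift assms)

text \<open>The Fubini hypothesis for composed convolutions: the inner sum of moduli is at most the
  l1 norm of \<open>b\<close> times \<open>B\<close>, uniformly in \<open>y\<close>, and
  \<open>a\<close> is summable.\<close>

lemma summable_conv_twice:
  fixes a b f :: "int \<Rightarrow> complex"
  assumes a: "a summable_on UNIV" and b: "b summable_on UNIV" and f: "\<And>n. norm (f n) \<le> B"
  shows "(\<lambda>(y, n). a (x - y) * (b (y - n) * f n)) summable_on (UNIV \<times> UNIV)"
proof -
  define S where "S = (\<Sum>\<^sub>\<infinity>n. norm (b n))"
  have b': "(\<lambda>n. norm (b n)) summable_on UNIV" using b by (simp add: norm_summable_complex)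
  have inner: "(\<lambda>n. norm (b (y - n) * f n)) summable_on UNIV" for y
    using summable_conv[OF b f, of y] by (simp only: norm_summable_complex)
  have le: "(\<Sum>\<^sub>\<infinity>n. norm (b (y - n) * f n)) \<le> S * B" for y
  proof -
    have "(\<lambda>n. norm (b (y - n))) summable_on UNIV"
      using b' by (simp only: summable_on_shift(2)[of "\<lambda>n. norm (b n)"])
    then have "(\<Sum>\<^sub>\<infinity>n. norm (b (y - n) * f n)) \<le> (\<Sum>\<^sub>\<infinity>n. norm (b (y - n)) * B)"
      by (intro infsum_mono inner summable_on_cmult_left) (auto simp: norm_mult intro!: mult_left_mono f)
    also have "\<dots> = S * B"
      unfolding S_def by (simp add: infsum_cmult_left' infsum_shift(2)[of "\<lambda>n. norm (b n)"])
    finally show ?thesis .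
  qed
  have "(\<lambda>p. norm (case p of (y, n) \<Rightarrow> a (x - y) * (b (y - n) * f n))) summable_on (UNIV \<times> UNIV)"
  proof (subst Infinite_Sum.abs_summable_on_Sigma_iff, intro conjI ballI)
    show "(\<lambda>n. norm (case (y, n) of (y, n) \<Rightarrow> a (x - y) * (b (y - n) * f n))) summable_on UNIV" for y
      using summable_on_cmult_right[OF inner, of "norm (a (x - y))" y] by (simp add: norm_mult)
    have "(\<lambda>y. norm (a (x - y)) * (S * B)) summable_on UNIV"
      using a by (intro summable_on_cmult_left)
        (simp only: norm_summable_complex[of "\<lambda>y. a (x - y)"] summable_on_shift(2)[of a])
    then have "(\<lambda>y. norm (a (x - y)) * (\<Sum>\<^sub>\<infinity>n. norm (b (y - n) * f n))) summable_on UNIV"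
      by (rule summable_on_comparison_test) (auto intro!: mult_left_mono le mult_nonneg_nonneg infsum_nonneg)
    then show "(\<lambda>y. norm (\<Sum>\<^sub>\<infinity>n. norm (case (y, n) of (y, n) \<Rightarrow> a (x - y) * (b (y - n) * f n)))) summable_on UNIV"
      by (simp add: norm_mult[of "a _"] infsum_cmult_right' infsum_nonneg abs_mult)
  qed
  then show ?thesis by (simp only: norm_summable_complex)
qed

text \<open>The weight is split as \<open>sqrt (a n)\<close> times itself: this is Cauchy-Schwarz
  for the measure \<open>a\<close>, applied to \<open>b\<close> and the constant one.\<close>

lemma infsum_cauchy_schwarz:
  fixes a b :: "'a \<Rightarrow> real"
  assumes a: "\<And>n. 0 \<le> a n" "a summable_on A" and b: "\<And>n. 0 \<le> b n"
    and ab: "(\<lambda>n. a n * b n) summable_on A" and ab2: "(\<lambda>n. a n * (b n)\<^sup>2) summable_on A"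
  shows "(infsum (\<lambda>n. a n * b n) A)\<^sup>2 \<le> infsum a A * infsum (\<lambda>n. a n * (b n)\<^sup>2) A"
proof -
  define R where "R = infsum a A * infsum (\<lambda>n. a n * (b n)\<^sup>2) A"
  have "infsum (\<lambda>n. a n * b n) A \<le> sqrt R"
  proof (rule infsum_le_finite_sums[OF ab])
    fix F assume F: "finite F" "F \<subseteq> A"
    have "(\<Sum>n\<in>F. a n * b n)\<^sup>2 = (\<Sum>n\<in>F. sqrt (a n) * (sqrt (a n) * b n))\<^sup>2"
      using a by (simp add: mult.assoc[symmetric])
    also have "\<dots> \<le> (\<Sum>n\<in>F. (sqrt (a n))\<^sup>2) * (\<Sum>n\<in>F. (sqrt (a n) * b n)\<^sup>2)"
      by (rule Cauchy_Schwarz_ineq_sum)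
    also have "\<dots> = sum a F * (\<Sum>n\<in>F. a n * (b n)\<^sup>2)"
      using a by (simp add: power_mult_distrib)
    also have "\<dots> \<le> R"
      unfolding R_def using a ab2 F
      by (intro mult_mono finite_sum_le_infsum) (auto intro!: sum_nonneg infsum_nonneg)
    finally show "(\<Sum>n\<in>F. a n * b n) \<le> sqrt R" by (rule real_le_rsqrt)
  qed
  moreover have "0 \<le> infsum (\<lambda>n. a n * b n) A" by (intro infsum_nonneg) (simp add: a b)
  ultimately have "(infsum (\<lambda>n. a n * b n) A)\<^sup>2 \<le> (sqrt R)\<^sup>2"
    by (intro power_mono)
  moreover have "0 \<le> R"
    unfolding R_def by (intro mult_nonneg_nonneg infsum_nonneg) (auto simp: a)
  ultimately show ?thesis by (simp add: R_def)
qed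

text \<open>Young's inequality for l1 and l2. Cauchy-Schwarz with weight
  \<open>norm (c (x - n))\<close> bounds the squared modulus at \<open>x\<close> by \<open>S\<close>
  times a weighted sum of the squares of \<open>f\<close>, which is summable in
  \<open>x\<close>.\<close>

lemma conv_in_ell2:
  assumes c: "c summable_on UNIV" and f: "f \<in> ell2"
  shows "conv c f \<in> ell2"
proof -
  have c': "(\<lambda>n. norm (c n)) summable_on UNIV" using c by (simp add: norm_summable_complex)
  have f2: "(\<lambda>n. (norm (f n))\<^sup>2) summable_on UNIV" using f by (simp add: ell2_def)
  define S where "S = (\<Sum>\<^sub>\<infinity>n. norm (c n))"
  define g where "g = (\<lambda>(x, n). norm (c (x - n)) * (norm (f n))\<^sup>2)"
  have shift: "(\<lambda>x. norm (c (x - n))) summable_on UNIV" "(\<lambda>n. norm (c (x - n))) summable_on UNIV" for n x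
    using c' by (simp_all only: summable_on_shift[of "\<lambda>n. norm (c n)"])
  \<comment> \<open>With \<open>x\<close> as the inner variable the double series is immediate: each
    inner sum is \<open>S * (norm (f n))\<^sup>2\<close>. The order needed below comes from the
    swap.\<close>
  have "(\<lambda>(n, x). g (x, n)) summable_on (UNIV \<times> UNIV)"
  proof -
    have "(\<lambda>p. norm (case p of (n, x) \<Rightarrow> g (x, n))) summable_on (UNIV \<times> UNIV)"
    proof (subst Infinite_Sum.abs_summable_on_Sigma_iff, intro conjI ballI)
      show "(\<lambda>x. norm (case (n, x) of (n, x) \<Rightarrow> g (x, n))) summable_on UNIV" for n
        by (simp add: g_def summable_on_cmult_left shift)
      show "(\<lambda>n. norm (\<Sum>\<^sub>\<infinity>x. norm (case (n, x) of (n, x) \<Rightarrow> g (x, n)))) summable_on UNIV"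
        by (simp add: g_def infsum_cmult_left' infsum_shift(1)[of "\<lambda>n. norm (c n)"] abs_mult
            summable_on_cmult_right f2)
    qed
    then show ?thesis by (rule abs_summable_summable)
  qed
  then have g: "g summable_on (UNIV \<times> UNIV)"
    by (subst summable_on_swap)
  have gx: "(\<lambda>n. norm (c (x - n)) * (norm (f n))\<^sup>2) summable_on UNIV" for x
    using summable_on_SigmaD1[of "\<lambda>x n. g (x, n)" UNIV "\<lambda>_. UNIV" x] g by (simp add: g_def)
  have "(\<lambda>x. \<Sum>\<^sub>\<infinity>n. g (x, n)) summable_on UNIV"
    using summable_on_Sigma_banach[of "\<lambda>x n. g (x, n)" UNIV "\<lambda>_. UNIV"] g by simp
  then have "(\<lambda>x. S * (\<Sum>\<^sub>\<infinity>n. g (x, n))) summable_on UNIV"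
    by (rule summable_on_cmult_right)
  then have "(\<lambda>x. (norm (conv c f x))\<^sup>2) summable_on UNIV"
  proof (rule summable_on_comparison_test)
    fix x
    obtain B where B: "\<And>n. norm (f n) \<le> B" using ell2_bounded[OF f] by blast
    have s: "(\<lambda>n. norm (c (x - n)) * norm (f n)) summable_on UNIV"
      using summable_conv[OF c B, of x] norm_summable_complex[of "\<lambda>n. c (x - n) * f n" UNIV]
      by (simp add: norm_mult)
    have "norm (conv c f x) \<le> (\<Sum>\<^sub>\<infinity>n. norm (c (x - n)) * norm (f n))"
      unfolding conv_def using norm_infsum_bound[of "\<lambda>n. c (x - n) * f n" UNIV] s
      by (simp add: norm_mult)
    then have "(norm (conv c f x))\<^sup>2 \<le> (\<Sum>\<^sub>\<infinity>n. norm (c (x - n)) * norm (f n))\<^sup>2"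
      by (intro power_mono) auto
    also have "\<dots> \<le> (\<Sum>\<^sub>\<infinity>n. norm (c (x - n))) * (\<Sum>\<^sub>\<infinity>n. norm (c (x - n)) * (norm (f n))\<^sup>2)"
      by (rule infsum_cauchy_schwarz) (use s shift gx in auto)
    also have "\<dots> = S * (\<Sum>\<^sub>\<infinity>n. g (x, n))"
      by (simp add: S_def g_def infsum_shift(2)[of "\<lambda>n. norm (c n)"])
    finally show "(norm (conv c f x))\<^sup>2 \<le> S * (\<Sum>\<^sub>\<infinity>n. g (x, n))" .
  qed simp
  then show ?thesis by (simp add: ell2_def)
qed

lemma ell2_inner_summable:
  assumes "f \<in> ell2" "g \<in> ell2"
  shows "(\<lambda>n. f n * cnj (g n)) summable_on UNIV"
proof -
  have "(\<lambda>n. norm (f n * cnj (g n))) summable_on UNIV"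
    by (rule abs_summable_product)
      (use assms in \<open>auto simp: ell2_def norm_mult power2_eq_square\<close>)
  then show ?thesis by (simp only: norm_summable_complex)
qed

lemma ell2_diff:
  assumes "f \<in> ell2" "g \<in> ell2"
  shows "(\<lambda>n. f n - g n) \<in> ell2"
proof -
  have "(\<lambda>n. 2 * (norm (f n))\<^sup>2 + 2 * (norm (g n))\<^sup>2) summable_on UNIV"
    using assms by (intro summable_on_add summable_on_cmult_right) (auto simp: ell2_def)
  then have "(\<lambda>n. (norm (f n - g n))\<^sup>2) summable_on UNIV"
  proof (rule summable_on_comparison_test)
    fix n
    have "(norm (f n - g n))\<^sup>2 \<le> (norm (f n) + norm (g n))\<^sup>2"
      by (intro power_mono norm_triangle_ineq4) auto
    also have "\<dots> \<le> 2 * (norm (f n))\<^sup>2 + 2 * (norm (g n))\<^sup>2"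
      using zero_le_power2[of "norm (f n) - norm (g n)"] by (simp add: power2_eq_square algebra_simps)
    finally show "(norm (f n - g n))\<^sup>2 \<le> 2 * (norm (f n))\<^sup>2 + 2 * (norm (g n))\<^sup>2" .
  qed simp
  then show ?thesis by (simp add: ell2_def)
qed

lemma ell2_inner_diff:
  assumes "f \<in> ell2" "g \<in> ell2" "h \<in> ell2"
  shows "ell2_inner (\<lambda>n. f n - g n) h = ell2_inner f h - ell2_inner g h"
proof -
  have "((\<lambda>n. f n * cnj (h n) + - (g n * cnj (h n))) has_sum (ell2_inner f h + - ell2_inner g h)) UNIV"
    unfolding ell2_inner_def
    by (intro has_sum_add has_sum_uminusI) (simp_all add: ell2_inner_summable assms)
  then show ?thesis
    by (simp add: ell2_inner_def[of "\<lambda>n. f n - g n"] infsumI left_diff_distrib)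
qed

lemma ell2_inner_self_eq_0:
  assumes "f \<in> ell2" "ell2_inner f f = 0"
  shows "f n = 0"
proof -
  have "(\<Sum>\<^sub>\<infinity>n. complex_of_real ((norm (f n))\<^sup>2)) = 0"
    using assms(2) by (simp only: ell2_inner_def complex_norm_square)
  moreover have "((\<lambda>n. complex_of_real ((norm (f n))\<^sup>2)) has_sum
      complex_of_real (\<Sum>\<^sub>\<infinity>n. (norm (f n))\<^sup>2)) UNIV"
    using assms(1) by (intro has_sum_of_real has_sum_infsum) (simp add: ell2_def)
  ultimately have "complex_of_real (\<Sum>\<^sub>\<infinity>n. (norm (f n))\<^sup>2) = 0"
    by (metis infsumI)
  then have "(\<Sum>\<^sub>\<infinity>n. (norm (f n))\<^sup>2) = 0" by simp
  then have "(norm (f n))\<^sup>2 = 0"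
    using nonneg_infsum_le_0D[of "\<lambda>n. (norm (f n))\<^sup>2" UNIV n] assms(1) by (simp add: ell2_def)
  then show ?thesis by simp
qed

lemma conv_diff:
  assumes "c summable_on UNIV" "f \<in> ell2" "g \<in> ell2"
  shows "conv c (\<lambda>n. f n - g n) = (\<lambda>x. conv c f x - conv c g x)"
proof
  fix x
  obtain B B' where B: "\<And>n. norm (f n) \<le> B" "\<And>n. norm (g n) \<le> B'"
    using ell2_bounded[OF assms(2)] ell2_bounded[OF assms(3)] by metis
  have "((\<lambda>n. c (x - n) * f n + - (c (x - n) * g n)) has_sum (conv c f x + - conv c g x)) UNIV"
    unfolding conv_def
    by (intro has_sum_add has_sum_uminusI)
      (simp_all add: summable_conv[OF assms(1) B(1)] summable_conv[OF assms(1) B(2)])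
  then show "conv c (\<lambda>n. f n - g n) x = conv c f x - conv c g x"
    by (simp add: conv_def[of c "\<lambda>n. f n - g n"] infsumI right_diff_distrib)
qed

lemma ell2_inner_conv:
  assumes c: "c summable_on UNIV" and f: "f \<in> ell2" and g: "g \<in> ell2"
  shows "ell2_inner (conv c f) g = ell2_inner f (conv (conv_adj c) g)"
proof -
  obtain B where B: "\<And>n. norm (f n) \<le> B" using ell2_bounded[OF f] by blast
  define h where "h x n = c (x - n) * f n * cnj (g x)" for x n
  have hs: "(\<lambda>n. norm (h x n)) summable_on UNIV" for x
    using summable_on_cmult_left[OF summable_conv[OF c B, of x], where c = "cnj (g x)"]
    by (simp only: norm_summable_complex h_def)
  \<comment> \<open>The convolution of the moduli is again in \<open>ell2\<close>, so its pairing
    with \<open>g\<close> converges absolutely; this is what permits the interchange of the two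
    sums.\<close>
  define c' f' where "c' n = complex_of_real (norm (c n))" "f' n = complex_of_real (norm (f n))" for n
  have c': "c' summable_on UNIV" and f': "f' \<in> ell2"
    using c f by (simp_all add: c'_f'_def[abs_def] norm_summable_complex[symmetric] ell2_def)
  have conv': "conv c' f' x = of_real (\<Sum>\<^sub>\<infinity>n. norm (c (x - n)) * norm (f n))" for x
    using norm_summable_complex[of "\<lambda>n. c (x - n) * f n" UNIV] summable_conv[OF c B, of x]
    unfolding conv_def c'_f'_def
    by (intro infsumI) (simp add: norm_mult has_sum_of_real_iff flip: of_real_mult)
  have "(\<lambda>x. norm (conv c' f' x * cnj (g x))) summable_on UNIV"
    using ell2_inner_summable[OF conv_in_ell2[OF c' f'] g] by (simp only: norm_summable_complex)
  then have "(\<lambda>x. \<Sum>\<^sub>\<infinity>n. norm (h x n)) summable_on UNIV"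
    by (simp add: conv' h_def norm_mult infsum_cmult_left' infsum_nonneg)
  then have "(\<lambda>p. norm (case p of (x, n) \<Rightarrow> h x n)) summable_on (UNIV \<times> UNIV)"
    by (subst Infinite_Sum.abs_summable_on_Sigma_iff) (simp add: hs infsum_nonneg)
  then have h: "(\<lambda>(x, n). h x n) summable_on (UNIV \<times> UNIV)"
    by (simp only: norm_summable_complex)
  have "ell2_inner (conv c f) g = (\<Sum>\<^sub>\<infinity>x. \<Sum>\<^sub>\<infinity>n. h x n)"
    by (simp add: ell2_inner_def conv_def h_def infsum_cmult_left')
  also have "\<dots> = (\<Sum>\<^sub>\<infinity>n. \<Sum>\<^sub>\<infinity>x. h x n)"
    by (rule infsum_swap_banach[OF h])
  also have "\<dots> = (\<Sum>\<^sub>\<infinity>n. f n * cnj (\<Sum>\<^sub>\<infinity>x. cnj (c (x - n)) * g x))"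
    by (subst infsum_cnj[symmetric])
      (simp add: h_def infsum_cmult_right'[symmetric] mult_ac del: infsum_cnj)
  also have "\<dots> = ell2_inner f (conv (conv_adj c) g)"
    by (simp add: ell2_inner_def conv_def conv_adj_def)
  finally show ?thesis .
qed

text \<open>The assumption \<open>unitary\<close> says that the columns of the convolution matrix
  are orthonormal. After the interchange of sums it turns the product with the adjoint into the
  identity matrix.\<close>

lemma conv_conv_adj_inverse:
  assumes c: "c summable_on UNIV" and f: "f \<in> ell2"
    and unitary: "\<And>x n. (\<Sum>\<^sub>\<infinity>y. cnj (c (y - x)) * c (y - n)) = (if x = n then 1 else 0)"
  shows "conv (conv_adj c) (conv c f) = f"
proof
  fix x
  obtain B where B: "\<And>n. norm (f n) \<le> B" using ell2_bounded[OF f] by blast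
  have "conv (conv_adj c) (conv c f) x =
      (\<Sum>\<^sub>\<infinity>y. \<Sum>\<^sub>\<infinity>n. conv_adj c (x - y) * (c (y - n) * f n))"
    by (simp add: conv_def infsum_cmult_right')
  also have "\<dots> = (\<Sum>\<^sub>\<infinity>n. \<Sum>\<^sub>\<infinity>y. conv_adj c (x - y) * (c (y - n) * f n))"
    by (rule infsum_swap_banach[OF summable_conv_twice[OF summable_conv_adj[OF c] c B]])
  also have "\<dots> = (\<Sum>\<^sub>\<infinity>n. (if x = n then 1 else 0) * f n)"
    by (simp add: conv_adj_def mult.assoc[symmetric] infsum_cmult_left' unitary)
  also have "\<dots> = (\<Sum>\<^sub>\<infinity>n\<in>{x}. f n)"
    by (rule infsum_cong_neutral) auto
  finally show "conv (conv_adj c) (conv c f) x = f x" by simp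
qed

section \<open>The projection onto the convolution image of the Hardy space sequences\<close>

definition nonneg_ell2 :: "(int \<Rightarrow> complex) set" where
  "nonneg_ell2 = {v \<in> ell2. \<forall>k<0. v k = 0}"

definition truncate :: "(int \<Rightarrow> complex) \<Rightarrow> int \<Rightarrow> complex" where
  "truncate u n = (if n < 0 then 0 else u n)"

lemma truncate_nonneg_ell2:
  assumes "u \<in> ell2"
  shows "truncate u \<in> nonneg_ell2"
proof -
  have "(\<lambda>n. (norm (u n))\<^sup>2) summable_on UNIV" using assms by (simp add: ell2_def)
  then have "(\<lambda>n. (norm (truncate u n))\<^sup>2) summable_on UNIV"
    by (rule summable_on_comparison_test) (auto simp: truncate_def)
  then show ?thesis by (auto simp: nonneg_ell2_def ell2_def truncate_def)
qed

text \<open>Truncation is the projection onto \<open>nonneg_ell2\<close>, and conjugating it by the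
  isometry \<open>conv c\<close> gives the projection onto the image. Uniqueness, which the definite
  description demands, holds because the difference of two candidates lies in the subspace and is
  orthogonal to it, hence to itself.\<close>

lemma orthogonal_projection_conv:
  assumes c: "c summable_on UNIV" and f: "f \<in> ell2"
    and unitary: "\<And>x n. (\<Sum>\<^sub>\<infinity>y. cnj (c (y - x)) * c (y - n)) = (if x = n then 1 else 0)"
  shows "orthogonal_projection (conv c ` nonneg_ell2) f = conv c (truncate (conv (conv_adj c) f))"
    (is "_ = ?g")
proof -
  let ?E = "conv c ` nonneg_ell2"
  define u where "u = conv (conv_adj c) f"
  have u: "u \<in> ell2" unfolding u_def by (rule conv_in_ell2[OF summable_conv_adj[OF c] f])
  have tu: "truncate u \<in> nonneg_ell2" by (rule truncate_nonneg_ell2[OF u])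
  then have tu2: "truncate u \<in> ell2" by (simp add: nonneg_ell2_def)
  have g: "?g \<in> ?E" "?g \<in> ell2"
    using tu tu2 conv_in_ell2[OF c] by (auto simp: u_def)
  have E2: "?E \<subseteq> ell2"
    using conv_in_ell2[OF c] by (auto simp: nonneg_ell2_def)
  have orth: "ell2_inner (\<lambda>n. f n - ?g n) h = 0" if "h \<in> ?E" for h
  proof -
    from that obtain v where v: "h = conv c v" "v \<in> ell2" "\<And>k. k < 0 \<Longrightarrow> v k = 0"
      by (auto simp: nonneg_ell2_def)
    have a: "ell2_inner w (conv c v) = ell2_inner (conv (conv_adj c) w) v" if "w \<in> ell2" for w
    proof -
      have "ell2_inner w (conv c v) = cnj (ell2_inner (conv c v) w)"
        by (simp add: ell2_inner_def mult.commute flip: infsum_cnj)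
      also have "\<dots> = cnj (ell2_inner v (conv (conv_adj c) w))"
        by (simp only: ell2_inner_conv[OF c v(2) that])
      also have "\<dots> = ell2_inner (conv (conv_adj c) w) v"
        by (simp add: ell2_inner_def mult.commute flip: infsum_cnj)
      finally show ?thesis .
    qed
    have "ell2_inner (\<lambda>n. f n - ?g n) h = ell2_inner u v - ell2_inner (truncate u) v"
      unfolding v(1) u_def[symmetric]
      by (simp only: ell2_inner_diff[OF f g(2)[folded u_def] conv_in_ell2[OF c v(2)]]
          a[OF f] a[OF g(2)[folded u_def]]
          conv_conv_adj_inverse[OF c tu2 unitary] u_def[symmetric])
    \<comment> \<open>Truncation changes \<open>u\<close> only at negative indices, where
      \<open>v\<close> vanishes.\<close>
    also have "ell2_inner (truncate u) v = ell2_inner u v"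
      unfolding ell2_inner_def by (rule infsum_cong) (use v(3) in \<open>auto simp: truncate_def\<close>)
    finally show ?thesis by simp
  qed
  show ?thesis
    unfolding orthogonal_projection_def
  proof (rule the_equality)
    show "?g \<in> ?E \<and> (\<forall>h\<in>?E. ell2_inner (\<lambda>n. f n - ?g n) h = 0)"
      using g orth by blast
  next
    fix g' assume g': "g' \<in> ?E \<and> (\<forall>h\<in>?E. ell2_inner (\<lambda>n. f n - g' n) h = 0)"
    define d where "d n = ?g n - g' n" for n
    have dE: "d \<in> ?E"
    proof -
      obtain v where v: "g' = conv c v" "v \<in> nonneg_ell2" using g' by blast
      then have "d = conv c (\<lambda>n. truncate u n - v n)"
        using conv_diff[OF c tu2, of v] by (auto simp: d_def[abs_def] nonneg_ell2_def u_def)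
      moreover have "(\<lambda>n. truncate u n - v n) \<in> nonneg_ell2"
        using ell2_diff tu v(2) by (auto simp: nonneg_ell2_def)
      ultimately show ?thesis by blast
    qed
    have g'2: "g' \<in> ell2" and d2: "d \<in> ell2" using g' dE E2 by auto
    have "ell2_inner d d = ell2_inner ?g d - ell2_inner g' d"
      using ell2_inner_diff[OF g(2) g'2 d2] by (simp add: d_def[abs_def])
    also have "\<dots> = ell2_inner (\<lambda>n. f n - g' n) d - ell2_inner (\<lambda>n. f n - ?g n) d"
      by (simp only: ell2_inner_diff[OF f g(2) d2] ell2_inner_diff[OF f g'2 d2]) simp
    also have "ell2_inner (\<lambda>n. f n - g' n) d = 0" using g' dE by blast
    also have "0 - ell2_inner (\<lambda>n. f n - ?g n) d = 0" using orth[OF dE] by simp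
    finally have "d n = 0" for n using ell2_inner_self_eq_0[OF d2] by blast
    then show "g' = ?g" by (auto simp: d_def)
  qed
qed

text \<open>The matrix product is multiplied out: the adjoint contributes
  \<open>conv_adj c (n - y) = cnj (c (y - n))\<close>, and the truncation restricts the middle index
  to \<open>n \<ge> 0\<close>.\<close>

lemma has_kernel_projection_conv:
  assumes c: "c summable_on UNIV"
    and unitary: "\<And>x n. (\<Sum>\<^sub>\<infinity>y. cnj (c (y - x)) * c (y - n)) = (if x = n then 1 else 0)"
  shows "has_kernel (orthogonal_projection (conv c ` nonneg_ell2))
    (\<lambda>x y. \<Sum>\<^sub>\<infinity>n\<in>{0..}. c (x - n) * cnj (c (y - n)))"
  unfolding has_kernel_def
proof (intro ballI allI)
  fix f x assume f: "f \<in> ell2"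
  obtain B where B: "\<And>n. norm (f n) \<le> B" using ell2_bounded[OF f] by blast
  let ?h = "\<lambda>n y. c (x - n) * (conv_adj c (n - y) * f y)"
  have "(\<lambda>(n, y). ?h n y) summable_on (UNIV \<times> UNIV)"
    by (rule summable_conv_twice[OF c summable_conv_adj[OF c] B])
  then have s: "(\<lambda>(n, y). ?h n y) summable_on ({0..} \<times> UNIV)"
    by (rule summable_on_subset) auto
  then have s': "(\<lambda>(y, n). ?h n y) summable_on (UNIV \<times> {0..})"
    by (subst summable_on_swap) (simp add: case_prod_unfold)
  have K: "(\<Sum>\<^sub>\<infinity>n\<in>{0..}. c (x - n) * cnj (c (y - n))) * f y = (\<Sum>\<^sub>\<infinity>n\<in>{0..}. ?h n y)" for y
    by (subst infsum_cmult_left'[symmetric]) (simp add: conv_adj_def mult_ac)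
  have "orthogonal_projection (conv c ` nonneg_ell2) f x = conv c (truncate (conv (conv_adj c) f)) x"
    by (simp only: orthogonal_projection_conv[OF c f unitary])
  also have "\<dots> = (\<Sum>\<^sub>\<infinity>n\<in>{0..}. c (x - n) * conv (conv_adj c) f n)"
    unfolding conv_def[of c] by (rule infsum_cong_neutral) (auto simp: truncate_def)
  also have "\<dots> = (\<Sum>\<^sub>\<infinity>n\<in>{0..}. \<Sum>\<^sub>\<infinity>y. ?h n y)"
    by (simp add: conv_def infsum_cmult_right')
  also have "\<dots> = (\<Sum>\<^sub>\<infinity>y. \<Sum>\<^sub>\<infinity>n\<in>{0..}. ?h n y)"
    by (rule infsum_swap_banach[OF s])
  finally have "orthogonal_projection (conv c ` nonneg_ell2) f x =
    (\<Sum>\<^sub>\<infinity>y. (\<Sum>\<^sub>\<infinity>n\<in>{0..}. c (x - n) * cnj (c (y - n))) * f y)" by (simp only: K)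
  moreover have "(\<lambda>y. (\<Sum>\<^sub>\<infinity>n\<in>{0..}. c (x - n) * cnj (c (y - n))) * f y) summable_on UNIV"
    unfolding K using summable_on_Sigma_banach[OF s'] by simp
  ultimately show "((\<lambda>y. (\<Sum>\<^sub>\<infinity>n\<in>{0..}. c (x - n) * cnj (c (y - n))) * f y) has_sum
      orthogonal_projection (conv c ` nonneg_ell2) f x) UNIV"
    by simp
qed

lemma operator_kernel_eq:
  assumes "has_kernel A K"
  shows "operator_kernel A = K"
  unfolding operator_kernel_def
proof (rule the_equality, rule assms)
  fix K' assume "has_kernel A K'"
  then show "K' = K"
    using has_kernel_entry[of A K'] has_kernel_entry[OF assms] by (simp add: fun_eq_iff)
qed

section \<open>The two kernels\<close>

lemma fourier_cong:
  assumes "\<And>z. z \<in> sphere 0 1 \<Longrightarrow> f z = g z"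
  shows "fourier f = fourier g"
proof -
  have "f (exp (\<i> * of_real \<theta>)) = g (exp (\<i> * of_real \<theta>))" for \<theta>
    by (rule assms) simp
  then show ?thesis by (simp add: fourier_def fun_eq_iff)
qed

lemma fourier_uminus: "fourier (\<lambda>z. - f z) k = - fourier f k"
  by (simp add: fourier_def set_lebesgue_integral_def)

lemma fourier_inverse: "fourier (\<lambda>z. f (inverse z)) k = fourier f (- k)"
proof -
  let ?h = "\<lambda>\<theta>. exp (- (\<i> * complex_of_real \<theta> * of_int k)) * f (inverse (exp (\<i> * complex_of_real \<theta>)))"
  have "(LBINT \<theta>:{-pi..pi}. ?h \<theta>) = (LBINT \<theta>:{\<theta>. - \<theta> \<in> {-pi..pi}}. ?h (- \<theta>))"
    by (rule set_integral_reflect)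
  also have "{\<theta>. - \<theta> \<in> {-pi..pi}} = {-pi..pi}" by auto
  finally show ?thesis
    by (simp add: fourier_def exp_minus)
qed

lemma conv_fourier:
  assumes F: "\<And>z. z \<in> sphere 0 1 \<Longrightarrow> ((\<lambda>n. c n * z powi n) has_sum F z) UNIV"
    and c: "c summable_on UNIV" and Fm: "F \<in> borel_measurable circle_measure"
    and H: "H \<in> L2_circle"
  shows "fourier (\<lambda>z. F z * H z) = conv c (fourier H)"
proof
  fix x
  show "fourier (\<lambda>z. F z * H z) x = conv c (fourier H) x"
    unfolding conv_def
    by (rule infsumI[symmetric, OF fourier_mult_has_sum[OF F c Fm L2_circle_integrable[OF H]]])
qed

lemma fourier_H2_eq:
  assumes F: "\<And>z. z \<in> sphere 0 1 \<Longrightarrow> ((\<lambda>n. c n * z powi n) has_sum F z) UNIV"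
    and c: "c summable_on UNIV" and Fm: "F \<in> borel_measurable circle_measure"
  shows "fourier_H2 F = conv c ` nonneg_ell2"
proof -
  have "fourier ` H2_circle = nonneg_ell2"
  proof (intro equalityI subsetI)
    fix v assume v: "v \<in> nonneg_ell2"
    then obtain H where "H \<in> L2_circle" "fourier H = v"
      using riesz_fischer[of v] by (auto simp: nonneg_ell2_def)
    with v show "v \<in> fourier ` H2_circle"
      by (auto simp: nonneg_ell2_def H2_circle_def)
  qed (auto simp: nonneg_ell2_def H2_circle_def fourier_L2_in_ell2)
  moreover have "fourier_H2 F = (\<lambda>H. conv c (fourier H)) ` H2_circle"
    unfolding fourier_H2_def using conv_fourier[OF F c Fm]
    by (force simp: H2_circle_def)
  ultimately show ?thesis by (metis image_image)
qed

text \<open>The product of \<open>F\<close> with its conjugate is the constant one on the circle,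
  and the sum is its Fourier coefficient at \<open>x - n\<close>.\<close>

lemma fourier_unimodular:
  assumes F: "\<And>z. z \<in> sphere 0 1 \<Longrightarrow> ((\<lambda>n. fourier F n * z powi n) has_sum F z) UNIV"
    and c: "fourier F summable_on UNIV" and Fm: "F \<in> borel_measurable circle_measure"
    and F1: "\<And>z. z \<in> sphere 0 1 \<Longrightarrow> norm (F z) = 1"
  shows "(\<Sum>\<^sub>\<infinity>y. cnj (fourier F (y - x)) * fourier F (y - n)) = (if x = n then 1 else 0)"
proof -
  have Fm': "(\<lambda>z. cnj (F z)) \<in> borel_measurable circle_measure"
    by (rule borel_measurable_cnj[OF Fm])
  have Fi: "integrable circle_measure (\<lambda>z. cnj (F z))"
    by (rule finite_measure.integrable_const_bound[OF finite_measure_circle _ Fm', of 1])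
      (auto intro!: AE_I2 simp: F1)
  have "((\<lambda>m. fourier F (x - n - m) * fourier (\<lambda>z. cnj (F z)) m) has_sum
      fourier (\<lambda>z. F z * cnj (F z)) (x - n)) UNIV"
    by (rule fourier_mult_has_sum[OF F c Fm Fi])
  moreover have "fourier (\<lambda>z. F z * cnj (F z)) = fourier (\<lambda>z. z powi 0)"
    by (rule fourier_cong) (simp add: F1 complex_norm_square[symmetric])
  ultimately have "((\<lambda>m. fourier F (x - n - m) * cnj (fourier F (- m))) has_sum
      (if x = n then 1 else 0)) UNIV"
    by (simp only: fourier_powi fourier_cnj[OF Fm]) simp
  also have "?this \<longleftrightarrow> ((\<lambda>y. cnj (fourier F (y - x)) * fourier F (y - n)) has_sum
      (if x = n then 1 else 0)) UNIV"
    by (rule has_sum_reindex_bij_witness[of _ "\<lambda>y. x - y" "\<lambda>m. x - m"]) (auto simp: mult.commute algebra_simps)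
  finally show ?thesis by (rule infsumI)
qed

section \<open>The Schur kernel as a series of products of coefficients\<close>

lemma double_contour_integral_sums:
  assumes f: "f holomorphic_on {z. a < norm z \<and> norm z < b}"
    and g: "g holomorphic_on {z. a < norm z \<and> norm z < b}"
    and radii: "0 \<le> a" "a < s" "s < 1" "1 < r" "r < b"
  shows "(\<lambda>n. fourier f (x + int n) * fourier g (- (y + int n))) sums
    (1 / (2 * \<i> * of_real pi)\<^sup>2 *
      contour_integral (circlepath 0 r) (\<lambda>z. contour_integral (circlepath 0 s) (\<lambda>w.
        f z * g w * (1 / (z - w)) * (1 / (z powi x * w powi (- y + 1))))))"
    (is "_ sums (1 / ?c\<^sup>2 * ?I)")
proof -
  have ab: "a < 1" "1 < b" and s0: "0 < s" and r0: "0 < r" using radii by auto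
  have cont: "continuous_on (sphere 0 t) h"
    if "h holomorphic_on {z. a < norm z \<and> norm z < b}" "a < t" "t < b"
    for t and h :: "complex \<Rightarrow> complex"
    by (rule continuous_on_subset[OF holomorphic_on_imp_continuous_on[OF that(1)]])
      (use that radii in auto)
  \<comment> \<open>The power of \<open>w\<close> in the n-th term is \<open>y - 1 + n\<close>;
    written as \<open>- k - 1\<close> it selects the coefficient \<open>k = - (y + n)\<close>. In
    the outer integral the exponent \<open>- x - n - 1\<close> selects
    \<open>k = x + n\<close>.\<close>
  define B where "B n = ?c * fourier g (- (y + int n))" for n
  define J where "J z = contour_integral (circlepath 0 s) (\<lambda>w. g w * w powi (y - 1) / (z - w))" for z
  have J: "(\<lambda>n. B n * (1 / z ^ Suc n)) sums J z" if z: "s < norm z" for z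
  proof -
    have "(\<lambda>n. contour_integral (circlepath 0 s) (\<lambda>w. g w * w powi (y - 1) * w ^ n) * (1 / z ^ Suc n)) sums J z"
      unfolding J_def
      by (rule contour_integral_cauchy_kernel_inner[OF s0 _ z])
        (use cont[OF g, of s] radii in \<open>auto intro!: continuous_intros\<close>)
    moreover have "contour_integral (circlepath 0 s) (\<lambda>w. g w * w powi (y - 1) * w ^ n) = B n" for n
    proof -
      have "contour_integral (circlepath 0 s) (\<lambda>w. g w * w powi (y - 1) * w ^ n) =
          contour_integral (circlepath 0 s) (\<lambda>w. g w * w powi (- (- (y + int n)) - 1))"
      proof (rule contour_integral_eq)
        fix w assume "w \<in> path_image (circlepath 0 s)"
        then have "w \<noteq> 0" using s0 by auto
        then have "w powi (y - 1) * w powi int n = w powi (- (- (y + int n)) - 1)"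
          by (subst power_int_add[symmetric]) (auto simp: algebra_simps)
        then show "g w * w powi (y - 1) * w ^ n = g w * w powi (- (- (y + int n)) - 1)"
          by (simp add: mult.assoc)
      qed
      also have "\<dots> = 2 * of_real pi * \<i> * fourier g (- (y + int n))"
        by (rule fourier_eq_contour_integral_annulus[OF g]) (use radii ab in auto)
      finally show ?thesis by (simp add: B_def)
    qed
    ultimately show ?thesis by (simp only:)
  qed
  \<comment> \<open>Boundedness of the inner coefficients suffices, since the radius
    \<open>r > 1\<close> supplies the geometric majorant of the outer series.\<close>
  obtain Cg where Cg: "\<And>n. norm (B n) \<le> Cg"
  proof -
    have "((\<lambda>k. fourier g k * 1 powi k) has_sum g 1) UNIV"
      by (rule fourier_has_sum_annulus[OF g]) (use radii in auto)
    then have "fourier g summable_on UNIV" by (auto dest: has_sum_imp_summable)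
    then have n: "(\<lambda>k. norm (fourier g k)) summable_on UNIV" by (simp add: norm_summable_complex)
    have "norm (B n) \<le> norm ?c * (\<Sum>\<^sub>\<infinity>k. norm (fourier g k))" for n
      using finite_sum_le_infsum[OF n, of "{- (y + int n)}"]
      unfolding B_def norm_mult[of ?c] by (intro mult_left_mono) auto
    then show ?thesis by (rule that)
  qed
  obtain Cf where Cf: "\<And>z. z \<in> sphere 0 r \<Longrightarrow> norm (f z * z powi (- x)) \<le> Cf"
  proof -
    have "continuous_on (sphere 0 r) (\<lambda>z. f z * z powi (- x))"
      using cont[OF f, of r] radii by (auto intro!: continuous_intros)
    from compact_imp_bounded[OF compact_continuous_image[OF this compact_sphere]]
    show ?thesis using that unfolding bounded_iff by blast
  qed
  have "(\<lambda>n. contour_integral (circlepath 0 r) (\<lambda>z. f z * z powi (- x) * (B n * (1 / z ^ Suc n)))) sums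
      contour_integral (circlepath 0 r) (\<lambda>z. f z * z powi (- x) * J z)"
  proof (rule contour_integral_circlepath_sums[OF r0])
    show "continuous_on (sphere 0 r) (\<lambda>z. f z * z powi (- x) * (B n * (1 / z ^ Suc n)))" for n
      using cont[OF f, of r] radii by (auto intro!: continuous_intros)
    show "norm (f z * z powi (- x) * (B n * (1 / z ^ Suc n))) \<le> Cf * (Cg * (1 / r) ^ Suc n)"
      if z: "z \<in> sphere 0 r" for n z
    proof -
      have "norm (B n * (1 / z ^ Suc n)) = norm (B n) * (1 / r) ^ Suc n"
        using z by (simp only: norm_mult norm_divide norm_power norm_one power_one_over) simp
      then have "norm (B n * (1 / z ^ Suc n)) \<le> Cg * (1 / r) ^ Suc n"
        using mult_right_mono[OF Cg, of "(1 / r) ^ Suc n" n] r0 by simp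
      then show ?thesis
        unfolding norm_mult[of "f z * z powi (- x)"]
        by (intro mult_mono Cf z norm_ge_zero order_trans[OF norm_ge_zero Cf[OF z]])
    qed
    have "summable (\<lambda>n. (1 / r) ^ Suc n)"
      using radii by (subst summable_Suc_iff) (auto intro!: summable_geometric)
    then show "summable (\<lambda>n. Cf * (Cg * (1 / r) ^ Suc n))"
      by (intro summable_mult)
    show "(\<lambda>n. f z * z powi (- x) * (B n * (1 / z ^ Suc n))) sums (f z * z powi (- x) * J z)"
      if "z \<in> sphere 0 r" for z
      by (rule sums_mult[OF J]) (use that radii in auto)
  qed
  moreover have "contour_integral (circlepath 0 r) (\<lambda>z. f z * z powi (- x) * (B n * (1 / z ^ Suc n))) =
      ?c\<^sup>2 * (fourier f (x + int n) * fourier g (- (y + int n)))" for n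
  proof -
    have "contour_integral (circlepath 0 r) (\<lambda>z. f z * z powi (- x) * (B n * (1 / z ^ Suc n))) =
        contour_integral (circlepath 0 r) (\<lambda>z. B n * (f z * z powi (- (x + int n) - 1)))"
    proof (rule contour_integral_eq)
      fix z assume "z \<in> path_image (circlepath 0 r)"
      then have z: "z \<noteq> 0" using r0 by auto
      have "1 / z ^ Suc n = z powi (- int (Suc n))"
        by (simp only: power_int_minus power_int_of_nat divide_inverse mult_1)
      moreover have "z powi (- x) * z powi (- int (Suc n)) = z powi (- (x + int n) - 1)"
      proof -
        have "- x + - int (Suc n) = - (x + int n) - 1" by simp
        then show ?thesis using z by (metis power_int_add)
      qed
      ultimately show "f z * z powi (- x) * (B n * (1 / z ^ Suc n)) = B n * (f z * z powi (- (x + int n) - 1))"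
        by (simp only: mult_ac)
    qed
    also have "\<dots> = B n * (2 * of_real pi * \<i> * fourier f (x + int n))"
      unfolding contour_integral_cmult
      by (subst fourier_eq_contour_integral_annulus[OF f]) (use radii ab in auto)
    finally show ?thesis by (simp add: B_def power2_eq_square mult_ac)
  qed
  moreover have "contour_integral (circlepath 0 r) (\<lambda>z. f z * z powi (- x) * J z) = ?I"
  proof (rule contour_integral_eq)
    fix z
    have "f z * z powi (- x) * J z =
        contour_integral (circlepath 0 s) (\<lambda>w. f z * z powi (- x) * (g w * w powi (y - 1) / (z - w)))"
      by (simp only: J_def contour_integral_cmult)
    also have "(\<lambda>w. f z * z powi (- x) * (g w * w powi (y - 1) / (z - w))) =
        (\<lambda>w. f z * g w * (1 / (z - w)) * (1 / (z powi x * w powi (- y + 1))))"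
    proof
      fix w :: complex
      have "w powi (y - 1) = inverse (w powi (- y + 1))" "z powi (- x) = inverse (z powi x)"
        using power_int_minus[of w "- y + 1"] by (simp_all add: power_int_minus)
      then show "f z * z powi (- x) * (g w * w powi (y - 1) / (z - w)) =
          f z * g w * (1 / (z - w)) * (1 / (z powi x * w powi (- y + 1)))"
        by (simp only: divide_inverse inverse_mult_distrib mult_ac mult_1)
    qed
    finally show "f z * z powi (- x) * J z = contour_integral (circlepath 0 s)
        (\<lambda>w. f z * g w * (1 / (z - w)) * (1 / (z powi x * w powi (- y + 1))))" .
  qed
  ultimately have "(\<lambda>n. ?c\<^sup>2 * (fourier f (x + int n) * fourier g (- (y + int n)))) sums ?I"
    by (simp only:)
  from sums_mult[OF this, of "1 / ?c\<^sup>2"] show ?thesis by simp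
qed

text \<open>On the circle the conjugate of \<open>G\<close> is \<open>- G\<close>, so conjugated
  coefficients are negated coefficients of opposite index. The conjugate terms of the exponent
  therefore form the negative half of the Laurent series.\<close>

lemma schur_exponent_eq:
  assumes G: "G holomorphic_on {z. a < norm z \<and> norm z < b}"
    and ab: "0 \<le> a" "a < 1" "1 < b"
    and im: "\<And>z. z \<in> sphere 0 1 \<Longrightarrow> Re (G z) = 0"
    and \<rho>: "\<And>k. k \<ge> 1 \<Longrightarrow> \<rho> (power_sum k) = of_nat k * fourier G (int k)"
    and z: "a < norm z" "norm z < b" and w: "a < norm w" "norm w < b"
  shows "schur_exponent \<rho> z w = G z - G w"
proof -
  define g where "g = fourier G"
  have cnj_g: "cnj (g k) = - g (- k)" for k
  proof -
    have "continuous_on (sphere 0 1) G"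
      by (rule continuous_on_subset[OF holomorphic_on_imp_continuous_on[OF G]]) (use ab in auto)
    then have m: "G \<in> borel_measurable circle_measure"
      by (rule borel_measurable_circle_continuous)
    have "fourier (\<lambda>z. cnj (G z)) = fourier (\<lambda>z. - G z)"
      by (rule fourier_cong) (simp add: im complex_eq_iff)
    then show ?thesis
      using fourier_cnj[OF m, of "- k"] by (simp add: fourier_uminus g_def)
  qed
  have coeff: "\<rho> (power_sum (Suc k)) / of_nat (Suc k) = g (int (Suc k))" for k
    using \<rho>[of "Suc k"] by (simp add: g_def del: of_nat_Suc)
  have coeff': "cnj (\<rho> (power_sum (Suc k))) / of_nat (Suc k) = - g (- int (Suc k))" for k
    using arg_cong[OF coeff[of k], of cnj] by (simp only: complex_cnj_divide complex_cnj_of_nat cnj_g)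
  define P where "P u = (\<Sum>n. g (int n) * u powi int n)" for u
  have pos: "(\<lambda>k. g (int (Suc k)) * u ^ Suc k) sums (P u - g 0)"
    and neg: "(\<lambda>k. g (- int (Suc k)) * u powi (- int (Suc k))) sums (G u - P u)"
    if "a < norm u" "norm u < b" for u
  proof -
    note series = fourier_series_annulus[OF G ab that, folded g_def, folded P_def]
    show "(\<lambda>k. g (- int (Suc k)) * u powi (- int (Suc k))) sums (G u - P u)"
      by (rule series(2))
    \<comment> \<open>The exponent starts at k = 1, so the constant coefficient is split off; it
      cancels in the difference of the values at \<open>z\<close> and \<open>w\<close>.\<close>
    show "(\<lambda>k. g (int (Suc k)) * u ^ Suc k) sums (P u - g 0)"
      using series(1) sums_Suc_iff[of "\<lambda>n. g (int n) * u ^ n" "P u - g 0"] by simp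
  qed
  have "(\<lambda>k. (g (int (Suc k)) * z ^ Suc k - g (int (Suc k)) * w ^ Suc k) +
      (g (- int (Suc k)) * z powi (- int (Suc k)) - g (- int (Suc k)) * w powi (- int (Suc k)))) sums
      ((P z - g 0 - (P w - g 0)) + ((G z - P z) - (G w - P w)))"
    by (intro sums_add sums_diff pos neg z w)
  then show ?thesis
    unfolding schur_exponent_def coeff coeff'
    by (simp add: sums_iff algebra_simps)
qed

lemma annulus_in_open_superset:
  fixes S :: "'a :: euclidean_space set"
  assumes "open S" "sphere 0 1 \<subseteq> S"
  obtains d where "0 < d" "d < 1" "{z. 1 - d < norm z \<and> norm z < 1 + d} \<subseteq> S"
proof -
  obtain e where e: "0 < e" "(\<Union>x\<in>sphere 0 1. ball x e) \<subseteq> S"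
    using compact_subset_open_imp_ball_epsilon_subset[OF compact_sphere assms] by blast
  show thesis
  \<comment> \<open>The bound 1/2 keeps the inner radius positive, so every point of the annulus can
    be projected radially to the circle, moving by \<open>\<bar>1 - norm z\<bar>\<close> <
    \<open>e\<close>.\<close>
  proof (rule that[of "min e (1/2)"])
    show "{z. 1 - min e (1/2) < norm z \<and> norm z < 1 + min e (1/2)} \<subseteq> S"
    proof
      fix z :: 'a assume z: "z \<in> {z. 1 - min e (1/2) < norm z \<and> norm z < 1 + min e (1/2)}"
      then have z0: "norm z > 0" by auto
      have "z /\<^sub>R norm z - z = (1 / norm z - 1) *\<^sub>R z"
        by (simp add: scaleR_diff_left divide_inverse)
      then have "dist (z /\<^sub>R norm z) z = \<bar>1 / norm z - 1\<bar> * norm z"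
        by (simp add: dist_norm)
      also have "\<dots> = \<bar>(1 / norm z - 1) * norm z\<bar>" by (simp add: abs_mult)
      also have "\<dots> = \<bar>1 - norm z\<bar>" using z0 by (simp add: left_diff_distrib)
      also have "\<dots> < e" using z by auto
      finally have "z \<in> ball (z /\<^sub>R norm z) e" by simp
      moreover have "z /\<^sub>R norm z \<in> sphere 0 1" using z0 by simp
      ultimately show "z \<in> S" using e(2) by blast
    qed
  qed (use e in auto)
qed

text \<open>The filter \<open>at_right 0\<close> renders "sufficiently small", with one threshold
  for all entries: the half-width \<open>d\<close> of an annulus on which \<open>G\<close> is
  holomorphic.\<close>

theorem proposition3p4:
  fixes G F :: "complex \<Rightarrow> complex" and S :: "complex set"
    and \<rho> :: "series \<Rightarrow> complex" and K\<^sub>F :: "int \<Rightarrow> int \<Rightarrow> complex"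
  assumes "open S" and "sphere 0 1 \<subseteq> S" and "G holomorphic_on S"
    and "\<And>z. z \<in> sphere 0 1 \<Longrightarrow> Re (G z) = 0"
    and "F = (\<lambda>z. exp (G (inverse z)))"
    and "K\<^sub>F = operator_kernel (orthogonal_projection (fourier_H2 F))"
    and "specialization \<rho>"
    and "\<And>k. k \<ge> 1 \<Longrightarrow> \<rho> (power_sum k) = of_nat k * fourier G (int k)"
  shows "\<forall>\<^sub>F \<epsilon> in at_right 0. \<forall>x y. K\<^sub>F x y = schur_kernel \<rho> \<epsilon> (- x) (- y)"
proof -
  obtain d where d: "0 < d" "d < 1" "{z. 1 - d < norm z \<and> norm z < 1 + d} \<subseteq> S"
    using annulus_in_open_superset[OF assms(1,2)] by blast
  have G: "G holomorphic_on {z. 1 - d < norm z \<and> norm z < 1 + d}"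
    using assms(3) d(3) holomorphic_on_subset by blast
  define E where "E z = exp (G z)" for z
  have E: "E holomorphic_on {z. 1 - d < norm z \<and> norm z < 1 + d}"
    unfolding E_def by (intro holomorphic_intros G)
  have E': "(\<lambda>z. exp (- G z)) holomorphic_on {z. 1 - d < norm z \<and> norm z < 1 + d}"
    by (intro holomorphic_intros G)
  have cont_E: "continuous_on (sphere 0 1) E"
    by (rule continuous_on_subset[OF holomorphic_on_imp_continuous_on[OF E]]) (use d in auto)
  define c where "c = fourier F"
  have cE: "c n = fourier E (- n)" for n
    unfolding c_def assms(5) E_def[symmetric] by (rule fourier_inverse)
  \<comment> \<open>Inversion carries this annulus into that of \<open>G\<close>; it contains the
    unit circle because 0 < \<open>d\<close> < 1.\<close>
  have F: "F holomorphic_on {z. 1 / (1 + d) < norm z \<and> norm z < 1 / (1 - d)}"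
  proof -
    have "inverse ` {z::complex. 1 / (1 + d) < norm z \<and> norm z < 1 / (1 - d)}
        \<subseteq> {z. 1 - d < norm z \<and> norm z < 1 + d}"
    proof (clarsimp simp: norm_inverse)
      fix z :: complex assume z: "1 / (1 + d) < norm z" "norm z < 1 / (1 - d)"
      then have "0 < norm z" using d by (smt (verit) divide_pos_pos)
      with z d show "1 - d < inverse (norm z) \<and> inverse (norm z) < 1 + d"
        by (simp add: field_simps)
    qed
    moreover have "inverse holomorphic_on {z::complex. 1 / (1 + d) < norm z \<and> norm z < 1 / (1 - d)}"
      by (intro holomorphic_intros) (use d in auto)
    ultimately have "(\<lambda>z. G (inverse z)) holomorphic_on {z. 1 / (1 + d) < norm z \<and> norm z < 1 / (1 - d)}"
      using holomorphic_on_compose_gen[OF _ G] by (fastforce simp: o_def)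
    then show ?thesis unfolding assms(5) by (intro holomorphic_intros)
  qed
  have F_sum: "((\<lambda>n. c n * z powi n) has_sum F z) UNIV" if "z \<in> sphere 0 1" for z
    unfolding c_def
    by (rule fourier_has_sum_annulus[OF F]) (use d that in \<open>auto simp: field_simps\<close>)
  have c: "c summable_on UNIV"
    using has_sum_imp_summable[OF F_sum[of 1]] by simp
  have "continuous_on (sphere 0 1) F"
    by (rule continuous_on_subset[OF holomorphic_on_imp_continuous_on[OF F]])
      (use d in \<open>auto simp: field_simps\<close>)
  then have Fm: "F \<in> borel_measurable circle_measure"
    by (rule borel_measurable_circle_continuous)
  have F1: "norm (F z) = 1" if "z \<in> sphere 0 1" for z
    using assms(4)[of "inverse z"] that by (simp add: assms(5) norm_exp_eq_Re norm_inverse)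
  have unitary: "(\<Sum>\<^sub>\<infinity>y. cnj (c (y - x)) * c (y - n)) = (if x = n then 1 else 0)" for x n
    unfolding c_def
    by (rule fourier_unimodular[OF F_sum[unfolded c_def] c[unfolded c_def] Fm F1])
  have K: "K\<^sub>F x y = (\<Sum>\<^sub>\<infinity>n\<in>{0..}. c (x - n) * cnj (c (y - n)))" for x y
  proof -
    have "fourier_H2 F = conv c ` nonneg_ell2"
      by (rule fourier_H2_eq[OF _ c Fm]) (rule F_sum)
    moreover have "operator_kernel (orthogonal_projection (conv c ` nonneg_ell2)) =
        (\<lambda>x y. \<Sum>\<^sub>\<infinity>n\<in>{0..}. c (x - n) * cnj (c (y - n)))"
      by (rule operator_kernel_eq, rule has_kernel_projection_conv[OF c]) (rule unitary)
    ultimately show ?thesis by (simp only: assms(6))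
  qed
  have K_sums: "(\<lambda>n. c (x - int n) * cnj (c (y - int n))) sums K\<^sub>F x y" for x y
  proof -
    have b: "norm (cnj (c (y - n))) \<le> (\<Sum>\<^sub>\<infinity>k. norm (c k))" for n
      using finite_sum_le_infsum[of "\<lambda>k. norm (c k)" UNIV "{y - n}"] c
      by (simp add: norm_summable_complex)
    have "(\<lambda>n. c (x - n) * cnj (c (y - n))) summable_on UNIV"
      by (rule summable_conv[OF c b])
    then have "(\<lambda>n. c (x - n) * cnj (c (y - n))) summable_on {0..}"
      by (rule summable_on_subset) simp
    then have "((\<lambda>n. c (x - n) * cnj (c (y - n))) has_sum K\<^sub>F x y) {0..}"
      unfolding K by (rule has_sum_infsum)
    also have "?this \<longleftrightarrow> ((\<lambda>n. c (x - int n) * cnj (c (y - int n))) has_sum K\<^sub>F x y) UNIV"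
      by (rule has_sum_reindex_bij_witness[of _ int nat]) auto
    finally show ?thesis by (rule has_sum_imp_sums)
  qed
  \<comment> \<open>The variable \<open>w\<close> runs off the unit circle, so the factor must be
    holomorphic; \<open>exp (- G z)\<close> equals the conjugate of \<open>E z\<close> on the circle
    and has the same coefficients.\<close>
  have E'_coeff: "fourier (\<lambda>z. exp (- G z)) k = cnj (fourier E (- k))" for k
  proof -
    have "fourier (\<lambda>z. exp (- G z)) = fourier (\<lambda>z. cnj (E z))"
    proof (rule fourier_cong)
      fix z :: complex assume "z \<in> sphere 0 1"
      then have "cnj (G z) = - G z" using assms(4) by (simp add: complex_eq_iff)
      then show "exp (- G z) = cnj (E z)" by (simp add: E_def exp_cnj)
    qed
    then show ?thesis
      by (simp only: fourier_cnj[OF borel_measurable_circle_continuous[OF cont_E]])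
  qed
  have "K\<^sub>F x y = schur_kernel \<rho> \<epsilon> (- x) (- y)" if \<epsilon>: "0 < \<epsilon>" "\<epsilon> < d" for \<epsilon> x y
  proof -
    let ?h = "\<lambda>z w. exp (schur_exponent \<rho> z w) * (1 / (z - w)) * (1 / (z powi (- x) * w powi (- (- y) + 1)))"
    let ?h' = "\<lambda>z w. E z * exp (- G w) * (1 / (z - w)) * (1 / (z powi (- x) * w powi (- (- y) + 1)))"
    have "contour_integral (circlepath 0 (1 + \<epsilon>)) (\<lambda>z. contour_integral (circlepath 0 (1 - \<epsilon>)) (?h z)) =
        contour_integral (circlepath 0 (1 + \<epsilon>)) (\<lambda>z. contour_integral (circlepath 0 (1 - \<epsilon>)) (?h' z))"
    proof (intro contour_integral_eq)
      fix z w assume z: "z \<in> path_image (circlepath 0 (1 + \<epsilon>))" and w: "w \<in> path_image (circlepath 0 (1 - \<epsilon>))"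
      have "schur_exponent \<rho> z w = G z - G w"
        by (rule schur_exponent_eq[OF G]) (use d \<epsilon> z w assms(4,8) in auto)
      then show "?h z w = ?h' z w" by (simp add: E_def exp_diff exp_minus divide_inverse)
    qed
    moreover have "(\<lambda>n. fourier E (- x + int n) * fourier (\<lambda>z. exp (- G z)) (- (- y + int n))) sums
        (1 / (2 * \<i> * of_real pi)\<^sup>2 * contour_integral (circlepath 0 (1 + \<epsilon>))
          (\<lambda>z. contour_integral (circlepath 0 (1 - \<epsilon>)) (?h' z)))"
      by (rule double_contour_integral_sums[OF E E']) (use d \<epsilon> in auto)
    \<comment> \<open>The inversion in \<open>F\<close> reverses indices: the coefficient of
      \<open>E\<close> at \<open>- x + n\<close> is \<open>c (x - n)\<close>, which explains the
      signs in the arguments of \<open>schur_kernel\<close>.\<close>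
    ultimately have "(\<lambda>n. c (x - int n) * cnj (c (y - int n))) sums schur_kernel \<rho> \<epsilon> (- x) (- y)"
      by (simp add: schur_kernel_def E'_coeff cE)
    then show ?thesis using K_sums sums_unique2 by blast
  qed
  then show ?thesis
    unfolding eventually_at_right_field using d(1) by blast
qed

end
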